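(* Let $\lambda\in\mathbb{R}^{n-d}$ and $U\in\mathbb{N}^n$ with $AU\in\mathrm{int}(\mathbb{R}_{\ge 0}A)$. Define a sequence $m^{(t)}\in\mathbb{R}_{>0}^n$, $t=0,1,2,\ldots$, by the following iterative proportional scaling (IPS) procedure: 1. $m^{(0)}:=\exp\big(\bar A^T(\bar A\bar A^T)^{-1}\lambda\big)$. 2. For $t=0,1,2,\ldots$, with $j=(t\bmod d)+1$, $$m_i^{(t+1)}:=m_i^{(t)}\exp(\mu^{(t)}a_{ji}),\qquad i=1,\ldots,n,$$ where $\mu^{(t)}\in\mathbb{R}$ is the unique solution of $$\sum_{i=1}^n a_{ji}m_i^{(t)}\exp(\mu^{(t)}a_{ji})=(AU)_j .$$ Then the limit $m=\lim_{t\to\infty}m^{(t)}$ exists and is the desired output of IPS, namely $m=p(\theta^* )$, where $\theta^*$ is the maximum likelihood estimate of $\theta$ in the log-affine model for the observation $U$; equivalently, $m$ is the unique vector in $\mathbb{R}_{>0}^n$ satisfying $$AU=Am\quad\text{and}\quad\lambda=\bar A\log m.$$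
   Context: $\mathbb{N}$ denotes the non-negative integers. $A=(a_{ji})$ is a $d\times n$ matrix with non-negative integer entries and rank $d$, which is a configuration matrix, i.e. $(1,\ldots,1)^T\in\mathbb{R}^n$ lies in the image of $A^T:\mathbb{R}^d\to\mathbb{R}^n$. $\mathbb{R}_{\ge0}A\subset\mathbb{R}^d$ is the cone of non-negative combinations of the columns of $A$. $\bar A$ (the Gale transform of $A$) is an $(n-d)\times n$ integer matrix whose rows form a $\mathbb{Z}$-basis of $\mathrm{Ker}(A:\mathbb{Z}^n\to\mathbb{Z}^d)$. Functions $\exp$ and $\log$ act on vectors componentwise, and $(\cdot)_j$ is the $j$-th entry of a vector. Log-affine model: with $\lambda$ fixed, $U$ takes values in $\mathbb{N}^n$ with Poisson probabilities $P(U=u)=\dfrac{p^u}{u!}\exp(-(p_1+\cdots+p_n))$, where $p^u=\prod_i p_i^{u_i}$, $u!=\prod_i u_i!$, and $p=p(\theta)=\exp\big(\bar A^T(\bar A\bar A^T)^{-1}\lambda+A^T\theta\big)$ with parameter $\theta\in\mathbb{R}^d$. The maximum likelihood estimate $\theta^*$ is the maximizer over $\theta\in\mathbb{R}^d$ of the probability of the observed $U$; it exists uniquely when $AU\in\mathrm{int}(\mathbb{R}_{\ge0}A)$. *)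

theory Defs
  imports
    "HOL-Analysis.Analysis"
    "Jordan_Normal_Form.Matrix_Kernel"
    "Jordan_Normal_Form.DL_Rank"
    "Jordan_Normal_Form.Gauss_Jordan_Elimination"
begin

unbundle no vec_syntax
hide_const (open) Finite_Cartesian_Product.vec
hide_type (open) Finite_Cartesian_Product.vec

abbreviation real_mat_of_nat :: "nat mat \<Rightarrow> real mat" where
  "real_mat_of_nat \<equiv> map_mat real"

abbreviation real_vec_of_nat :: "nat vec \<Rightarrow> real vec" where
  "real_vec_of_nat \<equiv> map_vec real"

abbreviation real_mat_of_int :: "int mat \<Rightarrow> real mat" where
  "real_mat_of_int \<equiv> map_mat real_of_int"

abbreviation exp_vec :: "real vec \<Rightarrow> real vec" where
  "exp_vec \<equiv> map_vec exp"

abbreviation log_vec :: "real vec \<Rightarrow> real vec" where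
  "log_vec \<equiv> map_vec ln"

text \<open>
  The Euclidean topology on the vectors of dimension \<open>n\<close>. It is pulled back from the product
  topology on functions; this is the right topology because all vectors of one dimension have
  the same index function outside their range, see the lemmas that follow.
\<close>

definition vec_topology :: "nat \<Rightarrow> real vec topology" where
  "vec_topology n = pullback_topology (carrier_vec n) vec_index euclidean"

lemma vec_index_outside:
  fixes x y :: "'a vec"
  assumes "x \<in> carrier_vec n" "y \<in> carrier_vec n" "n \<le> i"
  shows "x $ i = y $ i"
proof -
  have "z $ i = undef_vec (i - n)" if "z \<in> carrier_vec n" for z :: "'a vec"
    using that assms(3) unfolding carrier_vec_def mem_Collect_eq
    by transfer (auto simp: mk_vec_def)
  then show ?thesis using assms(1,2) by simp
qed

lemma limitin_vec_topology:
  "limitin (vec_topology n) f l F \<longleftrightarrow>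
    l \<in> carrier_vec n \<and> eventually (\<lambda>t. f t \<in> carrier_vec n) F \<and>
    (\<forall>i<n. ((\<lambda>t. f t $ i) \<longlongrightarrow> l $ i) F)"
  (is "?L \<longleftrightarrow> ?R")
proof
  assume L: ?L
  have l: "l \<in> carrier_vec n"
    using L by (auto simp: limitin_def vec_topology_def topspace_pullback_topology)
  have op: "openin (vec_topology n) (vec_index -` V \<inter> carrier_vec n)" if "open V" for V
    using that by (auto simp: vec_topology_def openin_pullback_topology)
  have ev: "eventually (\<lambda>t. f t \<in> vec_index -` V \<inter> carrier_vec n) F" if "open V" "vec_index l \<in> V" for V
    using L l op[OF that(1)] that(2) by (auto simp: limitin_def)
  have "eventually (\<lambda>t. f t \<in> carrier_vec n) F"
    using ev[of UNIV] by auto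
  moreover have "((\<lambda>t. f t $ i) \<longlongrightarrow> l $ i) F" for i
  proof (rule topological_tendstoI)
    fix S :: "real set" assume "open S" "l $ i \<in> S"
    then have "open ((\<lambda>h :: nat \<Rightarrow> real. h i) -` S)"
      by (intro open_vimage) (auto intro: continuous_on_product_coordinates)
    from ev[OF this] show "eventually (\<lambda>t. f t $ i \<in> S) F"
      using \<open>l $ i \<in> S\<close> by (auto elim: eventually_mono)
  qed
  ultimately show ?R using l by blast
next
  assume R: ?R
  have "((\<lambda>t. f t $ i) \<longlongrightarrow> l $ i) F" for i
  proof (cases "i < n")
    case False
    have "eventually (\<lambda>t. f t \<in> carrier_vec n) F" using R by blast
    then have "eventually (\<lambda>t. f t $ i = l $ i) F"
    proof eventually_elim
      case (elim t)
      then show ?case using R False vec_index_outside[of "f t" n l i] by simp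
    qed
    then show ?thesis by (rule tendsto_eventually)
  qed (use R in auto)
  then have "limitin (product_topology (\<lambda>_::nat. euclidean :: real topology) UNIV) (\<lambda>t. vec_index (f t)) (vec_index l) F"
    by (simp add: limitin_componentwise)
  then have "limitin euclidean (\<lambda>t. vec_index (f t)) (vec_index l) F"
    by (simp add: euclidean_product_topology)
  then have lim: "((\<lambda>t. vec_index (f t)) \<longlongrightarrow> vec_index l) F"
    by simp
  show ?L
    unfolding limitin_def
  proof (intro conjI allI impI)
    show "l \<in> topspace (vec_topology n)"
      using R by (auto simp: vec_topology_def topspace_pullback_topology)
    fix S assume "openin (vec_topology n) S \<and> l \<in> S"
    then obtain V where V: "open V" "S = vec_index -` V \<inter> carrier_vec n" "vec_index l \<in> V"
      by (auto simp: vec_topology_def openin_pullback_topology)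
    have "eventually (\<lambda>t. vec_index (f t) \<in> V) F"
      using topological_tendstoD[OF lim V(1,3)] .
    moreover have "eventually (\<lambda>t. f t \<in> carrier_vec n) F" using R by blast
    ultimately show "eventually (\<lambda>t. f t \<in> S) F"
      by eventually_elim (simp add: V(2))
  qed
qed

lemma interior_of_vec_topology:
  "x \<in> (vec_topology n) interior_of S \<longleftrightarrow>
    x \<in> carrier_vec n \<and>
    (\<exists>e>0. \<forall>y\<in>carrier_vec n. (\<forall>i<n. \<bar>y $ i - x $ i\<bar> < e) \<longrightarrow> y \<in> S)"
  (is "?L \<longleftrightarrow> ?R")
proof
  assume ?L
  then obtain V where V: "open V" "x \<in> carrier_vec n" "vec_index x \<in> V" "vec_index -` V \<inter> carrier_vec n \<subseteq> S"
    by (auto simp: interior_of_def vec_topology_def openin_pullback_topology)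
  have "openin (product_topology (\<lambda>_::nat. euclidean :: real topology) UNIV) V"
    using V(1) by (simp add: euclidean_product_topology)
  from product_topology_open_contains_basis[OF this V(3)] obtain X :: "nat \<Rightarrow> real set"
    where X: "vec_index x \<in> Pi\<^sub>E UNIV X" "\<And>i. open (X i)" "Pi\<^sub>E UNIV X \<subseteq> V"
    by auto
  have xX: "x $ i \<in> X i" for i
    using X(1) by (rule PiE_mem) simp
  have "\<exists>e>0. \<forall>r. \<bar>r - x $ i\<bar> < e \<longrightarrow> r \<in> X i" for i
    using xX[of i] X(2)[of i] unfolding open_dist dist_real_def by blast
  then obtain e where e: "\<And>i. e i > 0" "\<And>i r. \<bar>r - x $ i\<bar> < e i \<Longrightarrow> r \<in> X i"
    by metis
  define d where "d = Min (insert 1 (e ` {..<n}))"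
  have d: "d > 0" "\<And>i. i < n \<Longrightarrow> d \<le> e i"
    using e(1) by (auto simp: d_def)
  have "y \<in> S" if y: "y \<in> carrier_vec n" "\<forall>i<n. \<bar>y $ i - x $ i\<bar> < d" for y
  proof -
    have "y $ i \<in> X i" for i
    proof (cases "i < n")
      case True
      then have "\<bar>y $ i - x $ i\<bar> < e i" using y(2) d(2)[OF True] by force
      then show ?thesis by (rule e(2))
    next
      case False
      then have "y $ i = x $ i" using vec_index_outside[OF y(1) V(2)] by simp
      then show ?thesis using xX[of i] by simp
    qed
    then have "vec_index y \<in> V" using X(3) by (auto simp: PiE_UNIV_domain)
    then show ?thesis using V(4) y(1) by auto
  qed
  then show ?R using V(2) d(1) by blast
next
  assume ?R
  then obtain e where x: "x \<in> carrier_vec n" and e: "e > 0"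
    "\<And>y. y \<in> carrier_vec n \<Longrightarrow> \<forall>i<n. \<bar>y $ i - x $ i\<bar> < e \<Longrightarrow> y \<in> S"
    by blast
  define V where "V = (\<Inter>i<n. (\<lambda>h :: nat \<Rightarrow> real. h i) -` ball (x $ i) e)"
  have "open ((\<lambda>h :: nat \<Rightarrow> real. h i) -` ball (x $ i) e)" for i
    by (intro open_vimage) (auto intro: continuous_on_product_coordinates)
  then have "open V" unfolding V_def by (intro open_INT) auto
  then have "openin (vec_topology n) (vec_index -` V \<inter> carrier_vec n)"
    by (auto simp: vec_topology_def openin_pullback_topology)
  moreover have "x \<in> vec_index -` V \<inter> carrier_vec n"
    using x e(1) by (auto simp: V_def)
  moreover have "vec_index -` V \<inter> carrier_vec n \<subseteq> S"
    using e(2) by (auto simp: V_def dist_real_def abs_minus_commute)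
  ultimately show ?L unfolding interior_of_def by blast
qed

definition pos_vecs :: "nat \<Rightarrow> real vec set" where
  "pos_vecs n = {x \<in> carrier_vec n. \<forall>i<n. 0 < x $ i}"

definition configuration_matrix :: "nat mat \<Rightarrow> bool" where
  "configuration_matrix A \<longleftrightarrow>
    (\<exists>c\<in>carrier_vec (dim_row A).
      transpose_mat (real_mat_of_nat A) *\<^sub>v c = vec (dim_col A) (\<lambda>_. 1))"

definition column_cone :: "nat mat \<Rightarrow> real vec set" where
  "column_cone A =
    {real_mat_of_nat A *\<^sub>v x | x. x \<in> carrier_vec (dim_col A) \<and> (\<forall>i<dim_col A. 0 \<le> x $ i)}"

text \<open>
  The rows of \<open>B\<close> form a \<open>\<int>\<close>-basis of the integer kernel of \<open>A\<close>: the integer combinations of the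
  rows are the vectors \<open>transpose_mat B *\<^sub>v c\<close>, so the last two conjuncts say that the rows are
  linearly independent over \<open>\<int>\<close> and generate the kernel.
\<close>

definition gale_transform :: "nat mat \<Rightarrow> int mat \<Rightarrow> bool" where
  "gale_transform A B \<longleftrightarrow>
    B \<in> carrier_mat (dim_col A - dim_row A) (dim_col A) \<and>
    (\<forall>c\<in>carrier_vec (dim_row B).
      transpose_mat B *\<^sub>v c = 0\<^sub>v (dim_col B) \<longrightarrow> c = 0\<^sub>v (dim_row B)) \<and>
    {transpose_mat B *\<^sub>v c | c. c \<in> carrier_vec (dim_row B)} = mat_kernel (map_mat int A)"

text \<open>
  The rows of a Gale transform are linearly independent, so the Gram matrix below is invertible
  and \<open>mat_inverse\<close> does return its inverse.
\<close>

definition base_vec :: "int mat \<Rightarrow> real vec \<Rightarrow> real vec" where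
  "base_vec B lam =
    (let R = real_mat_of_int B
     in transpose_mat R *\<^sub>v (the (mat_inverse (R * transpose_mat R)) *\<^sub>v lam))"

definition model_point :: "nat mat \<Rightarrow> int mat \<Rightarrow> real vec \<Rightarrow> real vec \<Rightarrow> real vec" where
  "model_point A B lam \<theta> =
    exp_vec (base_vec B lam + transpose_mat (real_mat_of_nat A) *\<^sub>v \<theta>)"

definition poisson_prob :: "real vec \<Rightarrow> nat vec \<Rightarrow> real" where
  "poisson_prob p u =
    (\<Prod>i<dim_vec p. p $ i ^ (u $ i)) / (\<Prod>i<dim_vec p. fact (u $ i)) * exp (- (\<Sum>i<dim_vec p. p $ i))"

definition is_mle :: "nat mat \<Rightarrow> int mat \<Rightarrow> real vec \<Rightarrow> nat vec \<Rightarrow> real vec \<Rightarrow> bool" where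
  "is_mle A B lam U \<theta> \<longleftrightarrow>
    \<theta> \<in> carrier_vec (dim_row A) \<and>
    (\<forall>\<theta>'\<in>carrier_vec (dim_row A).
      poisson_prob (model_point A B lam \<theta>') U \<le> poisson_prob (model_point A B lam \<theta>) U)"

definition ips_equation :: "nat mat \<Rightarrow> nat vec \<Rightarrow> nat \<Rightarrow> real vec \<Rightarrow> real \<Rightarrow> bool" where
  "ips_equation A U j m \<mu> \<longleftrightarrow>
    (\<Sum>i<dim_col A. real (A $$ (j, i)) * m $ i * exp (\<mu> * real (A $$ (j, i)))) = real ((A *\<^sub>v U) $ j)"

text \<open>
  Rows are counted from \<open>0\<close>, so step \<open>t\<close> uses row \<open>t mod d\<close>. The description \<open>THE \<mu>\<close> is meaningful
  only where the equation has exactly one solution, which has to be shown.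
\<close>

primrec ips :: "nat mat \<Rightarrow> int mat \<Rightarrow> real vec \<Rightarrow> nat vec \<Rightarrow> nat \<Rightarrow> real vec" where
  "ips A B lam U 0 = exp_vec (base_vec B lam)"
| "ips A B lam U (Suc t) =
    (let m = ips A B lam U t; j = t mod dim_row A; \<mu> = (THE \<mu>. ips_equation A U j m \<mu>)
     in vec (dim_col A) (\<lambda>i. m $ i * exp (\<mu> * real (A $$ (j, i)))))"

end

theory Submission
  imports Defs
begin

text \<open>
  Iterative proportional scaling is coordinate descent for the generalised Kullback-Leibler
  divergence. Write \<open>kl u v = u * (ln u - ln v) - u + v\<close>. As \<open>AU\<close> is interior to the cone, there is
  a strictly positive \<open>x\<close> with \<open>A x = A U\<close>. A step of the procedure projects the current point onto
  the set where one coordinate of \<open>A m = A U\<close> holds, and the Pythagorean theorem says that it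
  decreases the divergence \<open>\<Sum>i. kl (x i) (m i)\<close> by exactly the divergence between the new and the
  old point. This has two consequences. The iterates remain bounded away from zero and
  infinity. Moreover \<open>kl u v \<ge> (sqrt u - sqrt v)\<^sup>2\<close> (\<open>sqrt_diff_le_kl\<close>), so consecutive iterates
  approach each other; as the step for an equation makes it exact, and each equation has its turn
  in every cycle of \<open>d\<close> steps, all residuals \<open>A m - A U\<close> tend to zero (\<open>residual_tendsto_0\<close>).

  All iterates have the form \<open>ln m = ln m\<^sub>0 + A\<^sup>T \<theta>\<close> with bounded \<open>\<theta>\<close>. For two iterates \<open>p\<close>, \<open>q\<close> with
  parameters \<open>\<theta>\<close>, \<open>\<eta>\<close> the symmetrised divergence is the scalar product of \<open>A (p - q)\<close> with \<open>\<theta> - \<eta>\<close>,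
  which is small when both residuals are. Hence the iterates are a Cauchy sequence
  (\<open>sqrt_m_Cauchy\<close>), and the limit \<open>m\<close> is a model point with \<open>A m = A U\<close> (\<open>m_converges\<close>).

  The Poisson likelihood at \<open>p\<close> is a constant times \<open>exp (- \<Sum>i. kl (U i) (p i))\<close>, and for a model
  point \<open>p\<close> the Pythagorean theorem gives
  \<open>\<Sum>i. kl (U i) (p i) = (\<Sum>i. kl (U i) (m i)) + (\<Sum>i. kl (m i) (p i))\<close>, so \<open>m\<close> is the only maximiser
  (\<open>fit_imp_unique_mle\<close>). Finally, for the description by \<open>A x = A U\<close> and \<open>\<lambda> = B (ln x)\<close>, where
  \<open>B\<close> is the Gale transform, note that the real kernel of \<open>A\<close> is the row space of \<open>B\<close>
  (\<open>kernel_eq_row_span\<close>). Hence if two positive vectors \<open>x\<close>, \<open>y\<close> satisfy both equations, then \<open>x - y\<close>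
  is orthogonal to \<open>ln x - ln y\<close>, and the symmetrised divergence of \<open>x\<close> and \<open>y\<close> is zero
  (\<open>fit_unique\<close>).
\<close>

unbundle no inner_syntax

section \<open>Generalised Kullback-Leibler divergence\<close>

text \<open>
  The divergence of unnormalised measures, one coordinate at a time. Since \<open>0 * ln 0 = 0\<close>, it
  takes the correct value \<open>kl 0 v = v\<close> at \<open>u = 0\<close>, so it may be applied to counts that vanish.
\<close>

definition kl :: "real \<Rightarrow> real \<Rightarrow> real" where
  "kl u v = u * (ln u - ln v) - u + v"

text \<open>
  If the last summand vanishes after summation over the coordinates, as it does when \<open>u\<close> has the
  same sufficient statistics as \<open>x\<close> and \<open>ln u - ln v\<close> is a combination of these statistics, this is
  the Pythagorean theorem of information geometry. Descent along the iteration and optimality of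
  its limit are both instances.
\<close>

lemma kl_pythagoras:
  "kl x v = kl x u + kl u v + (x - u) * (ln u - ln v)"
  by (simp add: kl_def algebra_simps)

text \<open>
  The comparison with the Hellinger distance: multiply \<open>ln (sqrt (v / u)) \<le> sqrt (v / u) - 1\<close> by
  \<open>2 * u\<close>. It turns small divergences into small distances, with a constant that does not depend
  on the points.
\<close>

lemma sqrt_diff_le_kl:
  assumes "0 \<le> u" "0 < v"
  shows "(sqrt u - sqrt v)\<^sup>2 \<le> kl u v"
proof (cases "u = 0")
  case True
  then show ?thesis using assms by (simp add: kl_def)
next
  case False
  then have u: "0 < u" using assms by simp
  have "ln (sqrt (v / u)) \<le> sqrt (v / u) - 1"
    using u assms by (intro ln_le_minus_one) simp
  moreover have "ln (sqrt (v / u)) = (ln v - ln u) / 2"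
    using u assms by (simp add: ln_sqrt ln_div)
  ultimately have "u * (ln v - ln u) \<le> u * (2 * sqrt (v / u) - 2)"
    using u by (intro mult_left_mono) auto
  moreover have "u * sqrt (v / u) = sqrt u * sqrt v"
    using u by (metis real_div_sqrt real_sqrt_divide less_imp_le mult.commute
        real_sqrt_mult_self abs_of_pos times_divide_eq_left times_divide_eq_right)
  ultimately have "u * (ln v - ln u) \<le> 2 * (sqrt u * sqrt v) - 2 * u"
    by (simp add: algebra_simps)
  moreover have "(sqrt u - sqrt v)\<^sup>2 = u + v - 2 * (sqrt u * sqrt v)"
    using u assms by (simp add: power2_diff)
  ultimately show ?thesis by (simp add: kl_def algebra_simps)
qed

lemma kl_nonneg: "0 \<le> u \<Longrightarrow> 0 < v \<Longrightarrow> 0 \<le> kl u v"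
  using sqrt_diff_le_kl[of u v] by (meson order_trans zero_le_power2)

text \<open>
  Sublevel sets of the divergence from a positive point are bounded in logarithmic coordinates: the
  Hellinger bound keeps \<open>v\<close> from growing, and the term \<open>- x * ln v\<close> keeps it from approaching zero.
\<close>

lemma kl_sublevel_bound:
  assumes "0 < x" "0 < v" "kl x v \<le> C"
  shows "\<bar>ln v\<bar> \<le> (sqrt x + sqrt C)\<^sup>2 + \<bar>(C + x - x * ln x) / x\<bar>"
proof -
  have "(sqrt v - sqrt x)\<^sup>2 \<le> C"
    using sqrt_diff_le_kl[of x v] assms by (simp add: power2_commute)
  then have "sqrt v - sqrt x \<le> sqrt C"
    using real_le_rsqrt by blast
  then have "(sqrt v)\<^sup>2 \<le> (sqrt x + sqrt C)\<^sup>2"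
    using assms by (intro power_mono) auto
  then have up: "ln v \<le> (sqrt x + sqrt C)\<^sup>2"
    using assms ln_le_minus_one[of v] by simp
  have "- (x * ln v) \<le> C + x - x * ln x"
    using assms by (simp add: kl_def algebra_simps)
  then have "- ln v \<le> (C + x - x * ln x) / x"
    using assms(1) by (simp add: pos_le_divide_eq algebra_simps)
  then have "- ln v \<le> \<bar>(C + x - x * ln x) / x\<bar>" by linarith
  moreover have "0 \<le> (sqrt x + sqrt C)\<^sup>2" by simp
  moreover have "0 \<le> \<bar>(C + x - x * ln x) / x\<bar>" by simp
  ultimately show ?thesis using up by linarith
qed

lemma sum_kl_eq_0D:
  assumes "finite I" "\<And>i. i \<in> I \<Longrightarrow> 0 \<le> u i" "\<And>i. i \<in> I \<Longrightarrow> 0 < v i"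
    and "(\<Sum>i\<in>I. kl (u i) (v i)) \<le> 0" "i \<in> I"
  shows "u i = v i"
proof -
  have "kl (u i) (v i) \<le> (\<Sum>i\<in>I. kl (u i) (v i))"
    using assms by (intro member_le_sum) (auto intro: kl_nonneg)
  then have "(sqrt (u i) - sqrt (v i))\<^sup>2 \<le> 0"
    using sqrt_diff_le_kl[OF assms(2,3)[OF assms(5)]] assms(4) by linarith
  then show ?thesis by simp
qed

section \<open>Convergence of iterative proportional scaling\<close>

text \<open>
  The iteration in coordinates. The target enters through a positive point \<open>x\<close> that attains it, and
  the linear independence of the rows of \<open>a\<close> through a right inverse \<open>g\<close>.
\<close>

locale iterative_scaling =
  fixes d n :: nat
    and a g :: "nat \<Rightarrow> nat \<Rightarrow> real"
    and x :: "nat \<Rightarrow> real"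
    and m :: "nat \<Rightarrow> nat \<Rightarrow> real"
    and \<mu> :: "nat \<Rightarrow> real"
  assumes d_pos: "0 < d"
    and x_pos: "i < n \<Longrightarrow> 0 < x i"
    and m_init: "i < n \<Longrightarrow> 0 < m 0 i"
    and m_step: "i < n \<Longrightarrow> m (Suc t) i = m t i * exp (\<mu> t * a (t mod d) i)"
    and m_fit: "(\<Sum>i<n. a (t mod d) i * m (Suc t) i) = (\<Sum>i<n. a (t mod d) i * x i)"
    and right_inverse: "j < d \<Longrightarrow> k < d \<Longrightarrow> (\<Sum>i<n. a k i * g j i) = (if k = j then 1 else 0)"
begin

lemma m_pos: "i < n \<Longrightarrow> 0 < m t i"
  by (induction t) (auto simp: m_init m_step)

lemma ln_m_step: "i < n \<Longrightarrow> ln (m (Suc t) i) - ln (m t i) = \<mu> t * a (t mod d) i"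
  using m_pos[of i t] by (simp add: m_step ln_mult)

text \<open>
  The log-linear coordinates of the \<open>t\<close>-th iterate relative to the starting point: each step moves
  one coordinate by \<open>\<mu> t\<close>.
\<close>

definition \<theta> :: "nat \<Rightarrow> nat \<Rightarrow> real" where
  "\<theta> t j = (\<Sum>s<t. if s mod d = j then \<mu> s else 0)"

lemma ln_m:
  assumes "i < n"
  shows "ln (m t i) = ln (m 0 i) + (\<Sum>j<d. a j i * \<theta> t j)"
proof (induction t)
  case 0
  then show ?case by (simp add: \<theta>_def)
next
  case (Suc t)
  have "(\<Sum>j<d. a j i * \<theta> (Suc t) j)
      = (\<Sum>j<d. a j i * \<theta> t j) + (\<Sum>j<d. if t mod d = j then a j i * \<mu> t else 0)"
    unfolding sum.distrib[symmetric]
    by (intro sum.cong) (auto simp: \<theta>_def algebra_simps)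
  also have "(\<Sum>j<d. if t mod d = j then a j i * \<mu> t else 0) = a (t mod d) i * \<mu> t"
    using d_pos by (simp add: sum.delta)
  finally show ?case
    using ln_m_step[OF assms, of t] Suc by (simp add: algebra_simps)
qed

text \<open>
  The right inverse recovers the log-linear coordinates from the iterate. They are therefore bounded
  when the logarithms are, and converge when the logarithms do.
\<close>

lemma theta_eq:
  assumes "j < d"
  shows "\<theta> t j = (\<Sum>i<n. g j i * (ln (m t i) - ln (m 0 i)))"
proof -
  have "(\<Sum>i<n. g j i * (ln (m t i) - ln (m 0 i))) = (\<Sum>i<n. \<Sum>k<d. (a k i * g j i) * \<theta> t k)"
    by (intro sum.cong) (auto simp: ln_m[of _ t] sum_distrib_left algebra_simps)
  also have "\<dots> = (\<Sum>k<d. (\<Sum>i<n. a k i * g j i) * \<theta> t k)"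
    by (subst sum.swap) (simp add: sum_distrib_right)
  also have "\<dots> = (\<Sum>k<d. if k = j then \<theta> t k else 0)"
    using assms by (intro sum.cong) (auto simp: right_inverse)
  also have "\<dots> = \<theta> t j" using assms by simp
  finally show ?thesis ..
qed

definition divergence :: "nat \<Rightarrow> real" where
  "divergence t = (\<Sum>i<n. kl (x i) (m t i))"

text \<open>
  One step is the projection of the current point onto the points with the right value of the
  statistic \<open>t mod d\<close>, so the Pythagorean theorem applies to it.
\<close>

lemma divergence_step: "divergence t = divergence (Suc t) + (\<Sum>i<n. kl (m (Suc t) i) (m t i))"
proof -
  have "(\<Sum>i<n. (x i - m (Suc t) i) * (ln (m (Suc t) i) - ln (m t i)))
      = (\<Sum>i<n. \<mu> t * (a (t mod d) i * x i) - \<mu> t * (a (t mod d) i * m (Suc t) i))"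
    by (intro sum.cong) (auto simp: ln_m_step algebra_simps)
  also have "\<dots> = 0"
    by (simp add: sum_subtractf sum_distrib_left[symmetric] m_fit)
  finally show ?thesis
    unfolding divergence_def using kl_pythagoras[of "x i" "m t i" "m (Suc t) i" for i]
    by (simp add: sum.distrib)
qed

lemma divergence_nonneg: "0 \<le> divergence t"
  unfolding divergence_def by (intro sum_nonneg kl_nonneg) (auto simp: m_pos x_pos less_imp_le)

lemma divergence_Suc_le: "divergence (Suc t) \<le> divergence t"
proof -
  have "0 \<le> (\<Sum>i<n. kl (m (Suc t) i) (m t i))"
    by (intro sum_nonneg kl_nonneg) (auto simp: m_pos less_imp_le)
  then show ?thesis by (simp add: divergence_step[of t])
qed

lemma ln_m_bounded: "\<exists>M. \<forall>t. \<forall>i<n. \<bar>ln (m t i)\<bar> \<le> M"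
proof -
  define h where "h i = (sqrt (x i) + sqrt (divergence 0))\<^sup>2 + \<bar>(divergence 0 + x i - x i * ln (x i)) / x i\<bar>" for i
  have "\<bar>ln (m t i)\<bar> \<le> (\<Sum>k<n. h k)" if "i < n" for t i
  proof -
    have "kl (x i) (m t i) \<le> divergence t"
      unfolding divergence_def using that
      by (intro member_le_sum) (auto intro!: kl_nonneg simp: m_pos x_pos less_imp_le)
    also have "divergence t \<le> divergence 0" by (rule lift_Suc_antimono_le[of divergence, OF divergence_Suc_le]) simp
    finally have "\<bar>ln (m t i)\<bar> \<le> h i"
      unfolding h_def by (intro kl_sublevel_bound) (auto simp: that x_pos m_pos)
    also have "h i \<le> (\<Sum>k<n. h k)"
      using that by (intro member_le_sum) (auto simp: h_def)
    finally show ?thesis .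
  qed
  then show ?thesis by blast
qed

text \<open>
  The divergences from the target decrease and are nonnegative, hence their differences tend to
  zero. These differences dominate the squared Hellinger distances of consecutive iterates, and
  boundedness passes from square roots to the iterates themselves.
\<close>

lemma m_step_diff_tendsto_0:
  assumes i: "i < n"
  shows "(\<lambda>t. m (Suc t) i - m t i) \<longlonglongrightarrow> 0"
proof -
  obtain M where M: "\<And>t i. i < n \<Longrightarrow> \<bar>ln (m t i)\<bar> \<le> M"
    using ln_m_bounded by blast
  have sq: "sqrt (m t i) \<le> sqrt (exp M)" for t
  proof -
    have "ln (m t i) \<le> M" using M[OF i, of t] by linarith
    then have "exp (ln (m t i)) \<le> exp M" by simp
    then show ?thesis using m_pos[OF i, of t] by simp
  qed
  obtain L where L: "divergence \<longlonglongrightarrow> L"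
    using decseq_convergent[OF decseq_SucI[of divergence, OF divergence_Suc_le], of 0] divergence_nonneg by blast
  have "(\<lambda>t. divergence t - divergence (Suc t)) \<longlonglongrightarrow> L - L"
    by (intro tendsto_diff L LIMSEQ_Suc)
  then have D0: "(\<lambda>t. divergence t - divergence (Suc t)) \<longlonglongrightarrow> 0" by simp
  have le: "(sqrt (m (Suc t) i) - sqrt (m t i))\<^sup>2 \<le> divergence t - divergence (Suc t)" for t
  proof -
    have "(sqrt (m (Suc t) i) - sqrt (m t i))\<^sup>2 \<le> kl (m (Suc t) i) (m t i)"
      using i by (intro sqrt_diff_le_kl) (auto simp: m_pos less_imp_le)
    also have "\<dots> \<le> (\<Sum>i<n. kl (m (Suc t) i) (m t i))"
      using i by (intro member_le_sum) (auto intro!: kl_nonneg simp: m_pos less_imp_le)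
    finally show ?thesis by (simp add: divergence_step[of t])
  qed
  have "(\<lambda>t. (sqrt (m (Suc t) i) - sqrt (m t i))\<^sup>2) \<longlonglongrightarrow> 0"
    by (rule tendsto_sandwich[OF _ _ tendsto_const D0]) (auto simp: le)
  from tendsto_real_sqrt[OF this]
  have s0: "(\<lambda>t. sqrt (m (Suc t) i) - sqrt (m t i)) \<longlonglongrightarrow> 0"
    by (simp add: tendsto_rabs_zero_iff)
  have *: "norm (m (Suc t) i - m t i) \<le> norm (sqrt (m (Suc t) i) - sqrt (m t i)) * (2 * sqrt (exp M))" for t
  proof -
    have "m (Suc t) i - m t i
        = (sqrt (m (Suc t) i) - sqrt (m t i)) * (sqrt (m (Suc t) i) + sqrt (m t i))"
      using m_pos[OF i, of t] m_pos[OF i, of "Suc t"] by (simp add: algebra_simps)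
    then show ?thesis
      using add_mono[OF sq[of "Suc t"] sq[of t]] m_pos[OF i, of t] m_pos[OF i, of "Suc t"]
      by (simp only: norm_mult) (intro mult_left_mono, simp_all del: real_sqrt_le_iff)
  qed
  show ?thesis
    by (rule tendsto_0_le[OF s0, of _ "2 * sqrt (exp M)"]) (use * in \<open>auto intro!: always_eventually\<close>)
qed

definition residual :: "nat \<Rightarrow> nat \<Rightarrow> real" where
  "residual j t = (\<Sum>i<n. a j i * m t i) - (\<Sum>i<n. a j i * x i)"

text \<open>
  The residual of row \<open>j\<close> is exactly zero right after each step that uses that row. Such a step
  occurs in every cycle, and over boundedly many steps the iterates hardly move any more.
\<close>

lemma residual_tendsto_0:
  assumes j: "j < d"
  shows "residual j \<longlonglongrightarrow> 0"
proof -
  have "(\<lambda>t. \<Sum>i<n. a j i * (m (Suc t) i - m t i)) \<longlonglongrightarrow> (\<Sum>i<n. a j i * 0)"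
    by (intro tendsto_sum tendsto_mult tendsto_const m_step_diff_tendsto_0) simp
  then have step: "(\<lambda>t. residual j (Suc t) - residual j t) \<longlonglongrightarrow> 0"
    by (simp add: residual_def sum_subtractf algebra_simps)
  have shift: "(\<lambda>t. residual j (t + k) - residual j t) \<longlonglongrightarrow> 0" for k
  proof (induction k)
    case (Suc k)
    have "(\<lambda>t. (residual j (Suc (t + k)) - residual j (t + k)) + (residual j (t + k) - residual j t)) \<longlonglongrightarrow> 0 + 0"
      by (intro tendsto_add Suc LIMSEQ_ignore_initial_segment[OF step])
    then show ?case by simp
  qed simp
  have "(\<lambda>t. \<Sum>k\<le>2 * d. \<bar>residual j (t + k) - residual j t\<bar>) \<longlonglongrightarrow> (\<Sum>k\<le>2 * d. 0)"
    by (intro tendsto_sum tendsto_rabs_zero shift)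
  then have lim: "(\<lambda>t. \<Sum>k\<le>2 * d. \<bar>residual j (t + k) - residual j t\<bar>) \<longlonglongrightarrow> 0" by simp
  have "norm (residual j t) \<le> norm (\<Sum>k\<le>2 * d. \<bar>residual j (t + k) - residual j t\<bar>) * 1" for t
  proof -
    \<comment> \<open>The step \<open>t + k\<close> uses row \<open>j\<close>; the summand \<open>d\<close> keeps the subtraction from being truncated.\<close>
    define k where "k = d + j - t mod d"
    have kd: "Suc k \<le> 2 * d" and "t mod d < d"
      using j d_pos mod_less_divisor[of d t] by (auto simp: k_def)
    have "t + k = j + d * (t div d + 1)"
      using \<open>t mod d < d\<close> mult_div_mod_eq[of d t] unfolding k_def distrib_left by linarith
    then have "(t + k) mod d = j" using j by (simp only: mod_mult_self2 mod_less)
    then have "residual j (t + Suc k) = 0"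
      using m_fit[of "t + k"] by (simp add: residual_def)
    then have "norm (residual j t) = \<bar>residual j (t + Suc k) - residual j t\<bar>" by simp
    also have "\<dots> \<le> (\<Sum>k\<le>2 * d. \<bar>residual j (t + k) - residual j t\<bar>)"
      using kd by (intro member_le_sum[of "Suc k"]) auto
    finally show ?thesis by simp
  qed
  then show ?thesis
    by (intro tendsto_0_le[OF lim, of _ 1]) (auto intro!: always_eventually)
qed

text \<open>
  The symmetrised divergence of two iterates is
  \<open>\<Sum>i. (m s i - m t i) * (ln (m s i) - ln (m t i)) = \<Sum>j. (residual j s - residual j t) * (\<theta> s j - \<theta> t j)\<close>.
  The coordinates \<open>\<theta>\<close> are bounded and the residuals tend to zero, so the iterates form a Cauchy
  sequence in the Hellinger distance. The existence of a fitting point of the model is thus a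
  consequence of the convergence and not an ingredient of its proof.
\<close>

lemma sqrt_m_Cauchy:
  assumes i: "i < n"
  shows "Cauchy (\<lambda>t. sqrt (m t i))"
proof -
  obtain M where M: "\<And>t i. i < n \<Longrightarrow> \<bar>ln (m t i)\<bar> \<le> M"
    using ln_m_bounded by blast
  define T where "T = (\<Sum>j<d. \<Sum>k<n. \<bar>g j k\<bar> * (2 * M))"
  have T: "\<bar>\<theta> t j\<bar> \<le> T" if "j < d" for t j
  proof -
    have "\<bar>\<theta> t j\<bar> \<le> (\<Sum>k<n. \<bar>g j k * (ln (m t k) - ln (m 0 k))\<bar>)"
      unfolding theta_eq[OF that] by (rule sum_abs)
    also have "\<dots> \<le> (\<Sum>k<n. \<bar>g j k\<bar> * (2 * M))"
    proof (intro sum_mono)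
      fix k assume "k \<in> {..<n}"
      then have "\<bar>ln (m t k) - ln (m 0 k)\<bar> \<le> 2 * M"
        using M[of k t] M[of k 0] by simp
      then show "\<bar>g j k * (ln (m t k) - ln (m 0 k))\<bar> \<le> \<bar>g j k\<bar> * (2 * M)"
        unfolding abs_mult by (intro mult_left_mono) auto
    qed
    also have "\<dots> \<le> T"
      unfolding T_def using that M[OF i, of 0]
      by (intro member_le_sum[of j _ "\<lambda>j. \<Sum>k<n. \<bar>g j k\<bar> * (2 * M)"])
        (auto intro!: sum_nonneg mult_nonneg_nonneg)
    finally show ?thesis .
  qed
  define E where "E t = (\<Sum>j<d. 2 * T * \<bar>residual j t\<bar>)" for t
  have "E \<longlonglongrightarrow> (\<Sum>j<d. 2 * T * 0)"
    unfolding E_def by (intro tendsto_sum tendsto_mult tendsto_const tendsto_rabs_zero residual_tendsto_0) simp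
  then have E: "E \<longlonglongrightarrow> 0" by simp
  have key: "(sqrt (m s i) - sqrt (m t i))\<^sup>2 \<le> E s + E t" for s t
  proof -
    have "(sqrt (m s i) - sqrt (m t i))\<^sup>2 \<le> kl (m s i) (m t i)"
      using i by (intro sqrt_diff_le_kl) (auto simp: m_pos less_imp_le)
    also have "\<dots> \<le> (\<Sum>i<n. kl (m s i) (m t i))"
      using i by (intro member_le_sum) (auto intro!: kl_nonneg simp: m_pos less_imp_le)
    also have "\<dots> \<le> (\<Sum>i<n. kl (m s i) (m t i) + kl (m t i) (m s i))"
      by (intro sum_mono) (auto intro!: kl_nonneg simp: m_pos less_imp_le)
    also have "\<dots> = (\<Sum>i<n. (m s i - m t i) * (ln (m s i) - ln (m t i)))"
      by (intro sum.cong) (auto simp: kl_def algebra_simps)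
    also have "\<dots> = (\<Sum>i<n. \<Sum>j<d. (a j i * m s i - a j i * m t i) * (\<theta> s j - \<theta> t j))"
    proof (intro sum.cong refl)
      fix i assume "i \<in> {..<n}"
      then have "ln (m s i) - ln (m t i) = (\<Sum>j<d. a j i * (\<theta> s j - \<theta> t j))"
        by (simp add: ln_m[of i s] ln_m[of i t] sum_subtractf algebra_simps)
      then show "(m s i - m t i) * (ln (m s i) - ln (m t i))
          = (\<Sum>j<d. (a j i * m s i - a j i * m t i) * (\<theta> s j - \<theta> t j))"
        by (simp only: sum_distrib_left) (intro sum.cong, auto simp: algebra_simps)
    qed
    also have "\<dots> = (\<Sum>j<d. (residual j s - residual j t) * (\<theta> s j - \<theta> t j))"
      by (subst sum.swap) (simp add: residual_def sum_distrib_right[symmetric] sum_subtractf)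
    also have "\<dots> \<le> (\<Sum>j<d. (\<bar>residual j s\<bar> + \<bar>residual j t\<bar>) * (2 * T))"
    proof (intro sum_mono)
      fix j assume "j \<in> {..<d}"
      then have "\<bar>\<theta> s j - \<theta> t j\<bar> \<le> 2 * T"
        using T[of j s] T[of j t] by simp
      then have "\<bar>residual j s - residual j t\<bar> * \<bar>\<theta> s j - \<theta> t j\<bar> \<le> (\<bar>residual j s\<bar> + \<bar>residual j t\<bar>) * (2 * T)"
        by (intro mult_mono) auto
      then show "(residual j s - residual j t) * (\<theta> s j - \<theta> t j) \<le> (\<bar>residual j s\<bar> + \<bar>residual j t\<bar>) * (2 * T)"
        using abs_ge_self[of "(residual j s - residual j t) * (\<theta> s j - \<theta> t j)"] by (simp only: abs_mult)
    qed
    also have "\<dots> = E s + E t"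
      unfolding E_def sum.distrib[symmetric] by (intro sum.cong) (auto simp: algebra_simps)
    finally show ?thesis .
  qed
  show ?thesis
  proof (rule metric_CauchyI)
    fix e :: real assume e: "0 < e"
    then have "eventually (\<lambda>t. E t < e\<^sup>2 / 2) sequentially"
      by (intro order_tendstoD(2)[OF E]) simp
    then obtain N where N: "\<And>t. N \<le> t \<Longrightarrow> E t < e\<^sup>2 / 2"
      by (auto simp: eventually_sequentially)
    have "dist (sqrt (m s i)) (sqrt (m t i)) < e" if "N \<le> s" "N \<le> t" for s t
    proof -
      have "\<bar>sqrt (m s i) - sqrt (m t i)\<bar>\<^sup>2 < e\<^sup>2"
        using key[of s t] N[OF that(1)] N[OF that(2)] by simp
      then show ?thesis
        using e by (simp only: dist_real_def) (rule power2_less_imp_less, auto)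
    qed
    then show "\<exists>N. \<forall>s\<ge>N. \<forall>t\<ge>N. dist (sqrt (m s i)) (sqrt (m t i)) < e" by blast
  qed
qed

text \<open>
  The limit stays away from zero because the logarithms of the iterates are bounded; hence the
  logarithms and the log-linear coordinates converge as well, and the limit lies in the model.
\<close>

theorem m_converges:
  obtains p \<beta>
  where "\<And>i. i < n \<Longrightarrow> (\<lambda>t. m t i) \<longlonglongrightarrow> p i"
    and "\<And>i. i < n \<Longrightarrow> p i = m 0 i * exp (\<Sum>j<d. a j i * \<beta> j)"
    and "\<And>j. j < d \<Longrightarrow> (\<Sum>i<n. a j i * p i) = (\<Sum>i<n. a j i * x i)"
proof -
  obtain M where M: "\<And>t i. i < n \<Longrightarrow> \<bar>ln (m t i)\<bar> \<le> M"
    using ln_m_bounded by blast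
  have "\<exists>p. (\<lambda>t. m t i) \<longlonglongrightarrow> p" if i: "i < n" for i
  proof -
    obtain r where "(\<lambda>t. sqrt (m t i)) \<longlonglongrightarrow> r"
      using sqrt_m_Cauchy[OF i] by (auto simp: Cauchy_convergent_iff convergent_def)
    then have "(\<lambda>t. (sqrt (m t i))\<^sup>2) \<longlonglongrightarrow> r\<^sup>2" by (rule tendsto_power)
    then show ?thesis using m_pos[OF i] by (auto simp: less_imp_le)
  qed
  then obtain p where p: "\<And>i. i < n \<Longrightarrow> (\<lambda>t. m t i) \<longlonglongrightarrow> p i" by metis
  have p_pos: "0 < p i" if i: "i < n" for i
  proof -
    have "exp (- M) \<le> m t i" for t
    proof -
      have "- M \<le> ln (m t i)" using M[OF i, of t] by linarith
      then have "exp (- M) \<le> exp (ln (m t i))" by simp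
      then show ?thesis using m_pos[OF i, of t] by simp
    qed
    then have "exp (- M) \<le> p i"
      by (intro LIMSEQ_le_const[OF p[OF i]]) auto
    then show ?thesis using exp_gt_zero[of "- M"] by linarith
  qed
  have ln_lim: "(\<lambda>t. ln (m t i)) \<longlonglongrightarrow> ln (p i)" if "i < n" for i
    using p[OF that] p_pos[OF that] by (intro tendsto_ln) auto
  define \<beta> where "\<beta> j = (\<Sum>i<n. g j i * (ln (p i) - ln (m 0 i)))" for j
  have th: "(\<lambda>t. \<theta> t j) \<longlonglongrightarrow> \<beta> j" if "j < d" for j
    unfolding theta_eq[OF that] \<beta>_def
    by (intro tendsto_sum tendsto_mult tendsto_diff tendsto_const ln_lim) simp
  have ln_p: "ln (p i) = ln (m 0 i) + (\<Sum>j<d. a j i * \<beta> j)" if i: "i < n" for i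
  proof (rule LIMSEQ_unique[OF ln_lim[OF i]])
    have "(\<lambda>t. ln (m 0 i) + (\<Sum>j<d. a j i * \<theta> t j)) \<longlonglongrightarrow> ln (m 0 i) + (\<Sum>j<d. a j i * \<beta> j)"
      by (intro tendsto_intros th) simp
    then show "(\<lambda>t. ln (m t i)) \<longlonglongrightarrow> ln (m 0 i) + (\<Sum>j<d. a j i * \<beta> j)"
      by (simp only: ln_m[OF i, symmetric])
  qed
  have "p i = m 0 i * exp (\<Sum>j<d. a j i * \<beta> j)" if i: "i < n" for i
    using ln_p[OF i] p_pos[OF i] m_init[OF i] by (metis exp_add exp_ln)
  moreover have "(\<Sum>i<n. a j i * p i) = (\<Sum>i<n. a j i * x i)" if j: "j < d" for j
  proof -
    have "residual j \<longlonglongrightarrow> (\<Sum>i<n. a j i * p i) - (\<Sum>i<n. a j i * x i)"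
      unfolding residual_def by (intro tendsto_intros p) simp
    from LIMSEQ_unique[OF this residual_tendsto_0[OF j]] show ?thesis by simp
  qed
  ultimately show ?thesis using p that by blast
qed

end

text \<open>
  The left-hand side is strictly increasing in \<open>\<mu>\<close>. As the exponents are natural numbers, the
  nonzero ones are at least 1, which gives explicit points where the value is at most and at least \<open>b\<close>.
\<close>

lemma proportional_fit_ex1:
  fixes a :: "nat \<Rightarrow> nat"
  assumes m: "\<And>i. i < n \<Longrightarrow> 0 < m i" and k: "k < n" "0 < a k" and b: "0 < (b::real)"
  shows "\<exists>!\<mu>. (\<Sum>i<n. real (a i) * m i * exp (\<mu> * real (a i))) = b"
proof -
  define f where "f \<mu> = (\<Sum>i<n. real (a i) * m i * exp (\<mu> * real (a i)))" for \<mu>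
  define S where "S = (\<Sum>i<n. real (a i) * m i)"
  have m_nonneg: "0 \<le> m i" if "i < n" for i using m[OF that] by simp
  have term_le_f: "real (a k) * m k * exp (\<mu> * real (a k)) \<le> f \<mu>" for \<mu>
    unfolding f_def using k m_nonneg
    by (intro member_le_sum[of k _ "\<lambda>i. real (a i) * m i * exp (\<mu> * real (a i))"])
      (auto intro!: mult_nonneg_nonneg)
  have "0 < real (a k) * m k" using k m by simp
  also have "\<dots> \<le> S" using term_le_f[of 0] by (simp add: f_def S_def)
  finally have S: "0 < S" .
  have strict: "f \<mu> < f \<nu>" if "\<mu> < \<nu>" for \<mu> \<nu>
    unfolding f_def
  proof (rule sum_strict_mono_ex1)
    show "\<forall>i\<in>{..<n}. real (a i) * m i * exp (\<mu> * real (a i)) \<le> real (a i) * m i * exp (\<nu> * real (a i))"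
      using that m_nonneg by (auto intro!: mult_left_mono mult_right_mono mult_nonneg_nonneg)
    show "\<exists>i\<in>{..<n}. real (a i) * m i * exp (\<mu> * real (a i)) < real (a i) * m i * exp (\<nu> * real (a i))"
      using that m k by (intro bexI[of _ k]) auto
  qed simp
  define lo where "lo = min 0 (ln (b / S))"
  define hi where "hi = max 0 (ln (b / m k))"
  have "f lo \<le> (\<Sum>i<n. real (a i) * m i * exp lo)"
    unfolding f_def
  proof (intro sum_mono)
    fix i assume i: "i \<in> {..<n}"
    show "real (a i) * m i * exp (lo * real (a i)) \<le> real (a i) * m i * exp lo"
    proof (cases "a i = 0")
      case False
      then have "lo * real (a i) \<le> lo * 1"
        by (intro mult_left_mono_neg) (auto simp: lo_def)
      then show ?thesis using m_nonneg i by (auto intro!: mult_left_mono mult_nonneg_nonneg)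
    qed simp
  qed
  also have "\<dots> = S * exp lo" by (simp add: S_def sum_distrib_right)
  also have "\<dots> \<le> S * exp (ln (b / S))" using S by (intro mult_left_mono) (auto simp: lo_def)
  also have "\<dots> = b" using S b by simp
  finally have f_lo: "f lo \<le> b" .
  have "b = m k * exp (ln (b / m k))" using b m[OF k(1)] by simp
  also have "\<dots> \<le> m k * exp hi" using m[OF k(1)] by (intro mult_left_mono) (auto simp: hi_def)
  also have "\<dots> \<le> m k * exp (hi * real (a k))"
    using m[OF k(1)] k(2) mult_left_mono[of 1 "real (a k)" hi] by (intro mult_left_mono) (auto simp: hi_def)
  also have "\<dots> \<le> real (a k) * (m k * exp (hi * real (a k)))"
    using m[OF k(1)] k(2) mult_right_mono[of 1 "real (a k)" "m k * exp (hi * real (a k))"] by simp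
  also have "\<dots> \<le> f hi" using term_le_f[of hi] by (simp add: mult.assoc)
  finally have f_hi: "b \<le> f hi" .
  have "continuous_on {lo..hi} f"
    unfolding f_def by (intro continuous_intros)
  moreover have "lo \<le> hi" by (simp add: lo_def hi_def)
  ultimately obtain \<mu> where "f \<mu> = b"
    using IVT'[of f lo b hi] f_lo f_hi by blast
  moreover have "\<nu> = \<mu>" if "f \<nu> = b" for \<nu>
    using strict[of \<mu> \<nu>] strict[of \<nu> \<mu>] that \<open>f \<mu> = b\<close> by (cases \<mu> \<nu> rule: linorder_cases) auto
  ultimately have "\<exists>!\<mu>. f \<mu> = b" by (rule ex1I)
  then show ?thesis by (simp only: f_def)
qed

section \<open>Linear algebra of an integer matrix and its kernel\<close>

lemma scalar_prod_self_eq_0D: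
  fixes v :: "'a :: linordered_idom vec"
  assumes "v \<in> carrier_vec n" "v \<bullet> v = 0"
  shows "v = 0\<^sub>v n"
proof (rule eq_vecI)
  fix i assume "i < dim_vec (0\<^sub>v n :: 'a vec)"
  moreover have "(\<Sum>i\<in>{0..<n}. v $ i * v $ i) = 0"
    using assms by (simp add: scalar_prod_def)
  ultimately show "v $ i = 0\<^sub>v n $ i"
    by (simp add: sum_nonneg_eq_0_iff)
qed (use assms in simp)

lemma gram_mult_eq_0D:
  fixes B :: "'a :: linordered_idom mat"
  assumes B: "B \<in> carrier_mat k n" and v: "v \<in> carrier_vec k"
    and "(B * transpose_mat B) *\<^sub>v v = 0\<^sub>v k"
  shows "transpose_mat B *\<^sub>v v = 0\<^sub>v n"
proof (rule scalar_prod_self_eq_0D)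
  show Bv: "transpose_mat B *\<^sub>v v \<in> carrier_vec n" using B v by simp
  have "(transpose_mat B *\<^sub>v v) \<bullet> (transpose_mat B *\<^sub>v v) = v \<bullet> (B *\<^sub>v (transpose_mat B *\<^sub>v v))"
    by (rule transpose_vec_mult_scalar[OF B Bv v])
  also have "B *\<^sub>v (transpose_mat B *\<^sub>v v) = 0\<^sub>v k"
    using assms by (subst assoc_mult_mat_vec[symmetric]) auto
  finally show "(transpose_mat B *\<^sub>v v) \<bullet> (transpose_mat B *\<^sub>v v) = 0"
    using v by simp
qed

text \<open>
  Independence over the integers suffices for invertibility over the reals: the determinant of the
  Gram matrix is an integer, and if it vanished then an integer vector would be annihilated.
\<close>

lemma integer_gram_inverse:
  fixes B :: "int mat"
  assumes B: "B \<in> carrier_mat k n"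
    and indep: "\<And>c. c \<in> carrier_vec k \<Longrightarrow> transpose_mat B *\<^sub>v c = 0\<^sub>v n \<Longrightarrow> c = 0\<^sub>v k"
  obtains G where "mat_inverse (real_mat_of_int B * transpose_mat (real_mat_of_int B)) = Some G"
    and "G \<in> carrier_mat k k"
    and "real_mat_of_int B * transpose_mat (real_mat_of_int B) * G = 1\<^sub>m k"
    and "G * (real_mat_of_int B * transpose_mat (real_mat_of_int B)) = 1\<^sub>m k"
proof -
  let ?R = "real_mat_of_int B"
  have BB: "B * transpose_mat B \<in> carrier_mat k k" using B by simp
  have R: "?R * transpose_mat ?R = real_mat_of_int (B * transpose_mat B)"
    using B by (simp add: map_mat_transpose of_int_hom.mat_hom_mult[of B k n "transpose_mat B" k])
  have "det (B * transpose_mat B) \<noteq> 0"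
    using gram_mult_eq_0D[OF B] indep det_0_iff_vec_prod_zero[OF BB] by blast
  then have "det (?R * transpose_mat ?R) \<noteq> 0"
    unfolding R by simp
  then have unit: "?R * transpose_mat ?R \<in> Units (ring_mat TYPE(real) k ())"
    using B by (intro det_non_zero_imp_unit) auto
  have RR: "?R * transpose_mat ?R \<in> carrier_mat k k" using B by simp
  obtain G where "mat_inverse (?R * transpose_mat ?R) = Some G"
    using mat_inverse(1)[OF RR] unit by fastforce
  with mat_inverse(2)[OF RR this] show ?thesis using that by blast
qed

text \<open>
  The rows of \<open>A\<close> and \<open>R\<close> are \<open>n\<close> independent vectors in dimension \<open>n\<close>, so the square matrix with
  these rows is invertible. A kernel vector \<open>y\<close> of \<open>A\<close> minus its orthogonal projection onto the rows
  of \<open>R\<close> is annihilated by this matrix, hence zero.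
\<close>

lemma kernel_eq_row_span:
  fixes A R :: "real mat"
  assumes A: "A \<in> carrier_mat d n" and R: "R \<in> carrier_mat (n - d) n" and dn: "d \<le> n"
    and surj: "\<And>v. v \<in> carrier_vec d \<Longrightarrow> \<exists>y\<in>carrier_vec n. A *\<^sub>v y = v"
    and AR: "A * transpose_mat R = 0\<^sub>m d (n - d)"
    and G: "G \<in> carrier_mat (n - d) (n - d)" "R * transpose_mat R * G = 1\<^sub>m (n - d)"
      "G * (R * transpose_mat R) = 1\<^sub>m (n - d)"
    and y: "y \<in> carrier_vec n" "A *\<^sub>v y = 0\<^sub>v d"
  obtains c where "c \<in> carrier_vec (n - d)" "y = transpose_mat R *\<^sub>v c"
proof -
  let ?k = "n - d"
  have ARc: "A *\<^sub>v (transpose_mat R *\<^sub>v c) = 0\<^sub>v d" if "c \<in> carrier_vec ?k" for c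
  proof -
    have "A *\<^sub>v (transpose_mat R *\<^sub>v c) = (A * transpose_mat R) *\<^sub>v c"
      using A R that by (intro assoc_mult_mat_vec[symmetric]) auto
    then show ?thesis using that unfolding AR by (auto intro!: eq_vecI)
  qed
  define M where "M = A @\<^sub>r R"
  have M: "M \<in> carrier_mat n n"
    using carrier_append_rows[OF A R] dn by (simp add: M_def)
  have Mz: "M *\<^sub>v z = (A *\<^sub>v z) @\<^sub>v (R *\<^sub>v z)" if "z \<in> carrier_vec n" for z
    unfolding M_def by (rule mat_mult_append[OF A R that])
  \<comment> \<open>A left kernel vector \<open>w\<close> of \<open>M\<close> splits into \<open>\<alpha>\<close> and \<open>\<beta>\<close>, which are tested against vectors \<open>z\<close>.\<close>
  have "det (transpose_mat M) \<noteq> 0"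
  proof
    assume "det (transpose_mat M) = 0"
    then obtain w where w: "w \<in> carrier_vec n" "w \<noteq> 0\<^sub>v n" "transpose_mat M *\<^sub>v w = 0\<^sub>v n"
      using M det_0_iff_vec_prod_zero[of "transpose_mat M" n] by auto
    define \<alpha> where "\<alpha> = vec_first w d"
    define \<beta> where "\<beta> = vec_last w ?k"
    have w_split: "w = \<alpha> @\<^sub>v \<beta>"
      unfolding \<alpha>_def \<beta>_def using w(1) dn by simp
    have \<alpha>: "\<alpha> \<in> carrier_vec d" and \<beta>: "\<beta> \<in> carrier_vec ?k" by (auto simp: \<alpha>_def \<beta>_def)
    have orth: "\<alpha> \<bullet> (A *\<^sub>v z) + \<beta> \<bullet> (R *\<^sub>v z) = 0" if z: "z \<in> carrier_vec n" for z
    proof -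
      have "0 = w \<bullet> (M *\<^sub>v z)"
        using transpose_vec_mult_scalar[OF M z w(1)] w(3) z by simp
      also have "\<dots> = \<alpha> \<bullet> (A *\<^sub>v z) + \<beta> \<bullet> (R *\<^sub>v z)"
        unfolding Mz[OF z] w_split
        by (rule scalar_prod_append[OF \<alpha> \<beta>]) (use A R z in auto)
      finally show ?thesis by simp
    qed
    have R\<beta>: "transpose_mat R *\<^sub>v \<beta> \<in> carrier_vec n" using R \<beta> by simp
    have "\<beta> \<bullet> (R *\<^sub>v (transpose_mat R *\<^sub>v \<beta>)) = 0"
      using orth[OF R\<beta>] ARc[OF \<beta>] \<alpha> by simp
    then have "transpose_mat R *\<^sub>v \<beta> = 0\<^sub>v n"
      using transpose_vec_mult_scalar[OF R R\<beta> \<beta>] by (intro scalar_prod_self_eq_0D[OF R\<beta>]) simp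
    then have "(R * transpose_mat R) *\<^sub>v \<beta> = 0\<^sub>v ?k"
      using R \<beta> by (subst assoc_mult_mat_vec) auto
    then have "G *\<^sub>v ((R * transpose_mat R) *\<^sub>v \<beta>) = 0\<^sub>v ?k"
      using G by (auto intro!: eq_vecI)
    moreover have "G *\<^sub>v ((R * transpose_mat R) *\<^sub>v \<beta>) = (G * (R * transpose_mat R)) *\<^sub>v \<beta>"
      using G R \<beta> by (intro assoc_mult_mat_vec[symmetric]) auto
    ultimately have \<beta>0: "\<beta> = 0\<^sub>v ?k" using G(3) \<beta> by simp
    obtain z where z: "z \<in> carrier_vec n" "A *\<^sub>v z = \<alpha>" using surj[OF \<alpha>] by blast
    have "R *\<^sub>v z \<in> carrier_vec ?k" using R z by simp
    then have "\<alpha> \<bullet> \<alpha> = 0"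
      using orth[OF z(1)] unfolding z(2) \<beta>0 by simp
    then have "\<alpha> = 0\<^sub>v d" by (rule scalar_prod_self_eq_0D[OF \<alpha>])
    then have "w = 0\<^sub>v n" using \<beta>0 dn unfolding w_split by (auto intro!: eq_vecI)
    then show False using w(2) by simp
  qed
  then have det_M: "det M \<noteq> 0" using det_transpose[OF M] by simp
  define c where "c = G *\<^sub>v (R *\<^sub>v y)"
  have c: "c \<in> carrier_vec ?k" using G R y by (auto simp: c_def)
  define z where "z = y - transpose_mat R *\<^sub>v c"
  have Rc: "transpose_mat R *\<^sub>v c \<in> carrier_vec n" using R c by simp
  have z: "z \<in> carrier_vec n" using y Rc by (simp add: z_def)
  have "A *\<^sub>v z = A *\<^sub>v y - A *\<^sub>v (transpose_mat R *\<^sub>v c)"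
    unfolding z_def by (rule mult_minus_distrib_mat_vec[OF A y(1) Rc])
  then have Az: "A *\<^sub>v z = 0\<^sub>v d" using ARc[OF c] y by simp
  have "R *\<^sub>v (transpose_mat R *\<^sub>v c) = (R * transpose_mat R) *\<^sub>v c"
    using R c by (intro assoc_mult_mat_vec[symmetric]) auto
  also have "\<dots> = (R * transpose_mat R * G) *\<^sub>v (R *\<^sub>v y)"
    unfolding c_def using R G y by (intro assoc_mult_mat_vec[symmetric, of _ ?k ?k]) auto
  also have "\<dots> = R *\<^sub>v y" using G R y by simp
  finally have "R *\<^sub>v (transpose_mat R *\<^sub>v c) = R *\<^sub>v y" .
  moreover have "R *\<^sub>v z = R *\<^sub>v y - R *\<^sub>v (transpose_mat R *\<^sub>v c)"
    unfolding z_def by (rule mult_minus_distrib_mat_vec[OF R y(1) Rc])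
  moreover have "R *\<^sub>v y \<in> carrier_vec ?k" using R y by simp
  ultimately have "R *\<^sub>v z = 0\<^sub>v ?k" by simp
  with Az have "M *\<^sub>v z = 0\<^sub>v n"
    unfolding Mz[OF z] using dn by (auto intro!: eq_vecI)
  then have "z = 0\<^sub>v n"
    using det_M det_0_iff_vec_prod_zero[OF M] z by blast
  then have "y $ i = (transpose_mat R *\<^sub>v c) $ i" if "i < n" for i
  proof -
    have "z $ i = y $ i - (transpose_mat R *\<^sub>v c) $ i"
      using R that unfolding z_def by (intro index_minus_vec) auto
    then show ?thesis using \<open>z = 0\<^sub>v n\<close> that by simp
  qed
  then have "y = transpose_mat R *\<^sub>v c" using y(1) R by (intro eq_vecI) auto
  with c show ?thesis by (rule that)
qed

section \<open>Interior points of the column cone\<close>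

lemma interior_of_vec_topology_direction:
  assumes "b \<in> (vec_topology d) interior_of S" "v \<in> carrier_vec d"
  obtains \<delta> where "0 < \<delta>" "b + \<delta> \<cdot>\<^sub>v v \<in> S"
proof -
  obtain e where b: "b \<in> carrier_vec d" and e: "0 < e"
    and S: "\<And>y. y \<in> carrier_vec d \<Longrightarrow> \<forall>i<d. \<bar>y $ i - b $ i\<bar> < e \<Longrightarrow> y \<in> S"
    using assms(1) unfolding interior_of_vec_topology by blast
  define s where "s = (\<Sum>i<d. \<bar>v $ i\<bar>)"
  define \<delta> where "\<delta> = e / (1 + s)"
  have s: "0 \<le> s" by (simp add: s_def sum_nonneg)
  then have \<delta>: "0 < \<delta>" using e by (simp add: \<delta>_def)
  have "\<delta> * \<bar>v $ i\<bar> < e" if "i < d" for i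
  proof -
    have "\<bar>v $ i\<bar> \<le> s" unfolding s_def using that by (intro member_le_sum) auto
    then have "\<delta> * \<bar>v $ i\<bar> < \<delta> * (1 + s)" using \<delta> by (intro mult_strict_left_mono) auto
    also have "\<dots> = e" using s by (simp add: \<delta>_def)
    finally show ?thesis .
  qed
  then have "b + \<delta> \<cdot>\<^sub>v v \<in> S"
    using b assms(2) \<delta> by (intro S) (auto simp: abs_mult)
  with \<delta> show ?thesis by (rule that)
qed

text \<open>
  A cone with nonempty interior is not contained in a proper subspace: moving from \<open>A u\<close> a little in
  the direction \<open>v\<close> stays in the image of \<open>A\<close>.
\<close>

lemma interior_column_cone_surj:
  assumes A: "A \<in> carrier_mat d n"
    and b: "real_mat_of_nat A *\<^sub>v u \<in> (vec_topology d) interior_of (column_cone A)"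
    and u: "u \<in> carrier_vec n" and v: "v \<in> carrier_vec d"
  shows "\<exists>y\<in>carrier_vec n. real_mat_of_nat A *\<^sub>v y = v"
proof -
  let ?A = "real_mat_of_nat A"
  have A': "?A \<in> carrier_mat d n" using A by simp
  obtain \<delta> where \<delta>: "0 < \<delta>" "?A *\<^sub>v u + \<delta> \<cdot>\<^sub>v v \<in> column_cone A"
    using interior_of_vec_topology_direction[OF b v] .
  then obtain x where x: "x \<in> carrier_vec n" "?A *\<^sub>v u + \<delta> \<cdot>\<^sub>v v = ?A *\<^sub>v x"
    using A by (auto simp: column_cone_def)
  define y where "y = (1 / \<delta>) \<cdot>\<^sub>v (x - u)"
  have "?A *\<^sub>v y = (1 / \<delta>) \<cdot>\<^sub>v (?A *\<^sub>v x - ?A *\<^sub>v u)"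
    unfolding y_def using x u mult_mat_vec[OF A', of "x - u"] mult_minus_distrib_mat_vec[OF A' x(1) u]
    by simp
  also have "\<dots> = v"
  proof (rule eq_vecI)
    fix i assume i: "i < dim_vec v"
    have "(?A *\<^sub>v x - ?A *\<^sub>v u) $ i = \<delta> * v $ i"
      unfolding x(2)[symmetric] using A v i by simp
    then show "((1 / \<delta>) \<cdot>\<^sub>v (?A *\<^sub>v x - ?A *\<^sub>v u)) $ i = v $ i"
      using A v i \<delta>(1) by simp
  qed (use A v in simp)
  finally show ?thesis using x u by (intro bexI[of _ y]) (auto simp: y_def)
qed

text \<open>
  Subtract from \<open>b\<close> a small multiple of the sum of the columns; the result is still in the cone, and
  adding the multiple back makes all coefficients positive.
\<close>

lemma interior_column_cone_positive:
  assumes A: "A \<in> carrier_mat d n"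
    and b: "b \<in> (vec_topology d) interior_of (column_cone A)"
  obtains x where "x \<in> pos_vecs n" "real_mat_of_nat A *\<^sub>v x = b"
proof -
  let ?A = "real_mat_of_nat A"
  let ?e = "vec n (\<lambda>_. 1) :: real vec"
  have A': "?A \<in> carrier_mat d n" using A by simp
  have b': "b \<in> carrier_vec d" using b unfolding interior_of_vec_topology by blast
  have Ae: "?A *\<^sub>v ?e \<in> carrier_vec d" using A' by simp
  then have "- (?A *\<^sub>v ?e) \<in> carrier_vec d" by simp
  from interior_of_vec_topology_direction[OF b this]
  obtain \<delta> where \<delta>: "0 < \<delta>" "b + \<delta> \<cdot>\<^sub>v - (?A *\<^sub>v ?e) \<in> column_cone A" .
  then obtain y where y: "y \<in> carrier_vec n" "\<forall>i<n. 0 \<le> y $ i"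
    "b + \<delta> \<cdot>\<^sub>v - (?A *\<^sub>v ?e) = ?A *\<^sub>v y"
    using A by (auto simp: column_cone_def)
  define x where "x = y + \<delta> \<cdot>\<^sub>v ?e"
  have "?A *\<^sub>v x = ?A *\<^sub>v y + \<delta> \<cdot>\<^sub>v (?A *\<^sub>v ?e)"
    unfolding x_def using y(1) mult_mat_vec[OF A', of ?e] mult_add_distrib_mat_vec[OF A' y(1)] by simp
  also have "\<dots> = b"
    unfolding y(3)[symmetric]
  proof (rule eq_vecI)
    fix i assume i: "i < dim_vec b"
    then have "i < d" using b' by simp
    then have "((b + \<delta> \<cdot>\<^sub>v - (?A *\<^sub>v ?e)) + \<delta> \<cdot>\<^sub>v (?A *\<^sub>v ?e)) $ i
        = b $ i + \<delta> * - ((?A *\<^sub>v ?e) $ i) + \<delta> * ((?A *\<^sub>v ?e) $ i)"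
      using A' b' by (simp del: index_mult_mat_vec)
    then show "((b + \<delta> \<cdot>\<^sub>v - (?A *\<^sub>v ?e)) + \<delta> \<cdot>\<^sub>v (?A *\<^sub>v ?e)) $ i = b $ i" by simp
  qed (use A' b' in simp)
  finally have "?A *\<^sub>v x = b" .
  moreover have "x \<in> pos_vecs n"
    using y(1,2) \<delta>(1) by (auto simp: pos_vecs_def x_def add_nonneg_pos)
  ultimately show ?thesis using that by blast
qed

section \<open>The log-affine Poisson model\<close>

text \<open>
  Up to a factor that depends only on the data, the likelihood is the exponential of minus the
  divergence of the data from the model point. Maximising the likelihood is minimising the
  divergence.
\<close>

lemma poisson_prob_eq_kl:
  assumes p: "p \<in> pos_vecs n"
  shows "poisson_prob p u
    = exp (- (\<Sum>i<n. kl (real (u $ i)) (p $ i)))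
      * (\<Prod>i<n. exp (real (u $ i) * ln (real (u $ i)) - real (u $ i)) / fact (u $ i))"
proof -
  have dim: "dim_vec p = n" using p by (auto simp: pos_vecs_def)
  have "poisson_prob p u = (\<Prod>i<n. p $ i ^ (u $ i) / fact (u $ i) * exp (- p $ i))"
    unfolding poisson_prob_def dim
    by (simp add: prod.distrib prod_dividef exp_sum sum_negf[symmetric])
  also have "\<dots> = (\<Prod>i<n. exp (- kl (real (u $ i)) (p $ i))
      * (exp (real (u $ i) * ln (real (u $ i)) - real (u $ i)) / fact (u $ i)))"
  proof (intro prod.cong refl)
    fix i assume "i \<in> {..<n}"
    then have "0 < p $ i" using p by (simp add: pos_vecs_def)
    then have "p $ i ^ (u $ i) = exp (real (u $ i) * ln (p $ i))"
      by (simp add: exp_of_nat_mult)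
    then have "p $ i ^ (u $ i) * exp (- p $ i)
        = exp (- kl (real (u $ i)) (p $ i)) * exp (real (u $ i) * ln (real (u $ i)) - real (u $ i))"
      by (simp add: kl_def exp_add[symmetric] algebra_simps)
    then show "p $ i ^ (u $ i) / fact (u $ i) * exp (- p $ i)
        = exp (- kl (real (u $ i)) (p $ i))
          * (exp (real (u $ i) * ln (real (u $ i)) - real (u $ i)) / fact (u $ i))"
      by (simp only: times_divide_eq_left times_divide_eq_right)
  qed
  also have "\<dots> = exp (- (\<Sum>i<n. kl (real (u $ i)) (p $ i)))
      * (\<Prod>i<n. exp (real (u $ i) * ln (real (u $ i)) - real (u $ i)) / fact (u $ i))"
    by (simp add: prod.distrib exp_sum sum_negf[symmetric] del: times_divide_eq_right)
  finally show ?thesis .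
qed

lemma poisson_prob_le_iff:
  assumes "p \<in> pos_vecs n" "q \<in> pos_vecs n"
  shows "poisson_prob q u \<le> poisson_prob p u
    \<longleftrightarrow> (\<Sum>i<n. kl (real (u $ i)) (p $ i)) \<le> (\<Sum>i<n. kl (real (u $ i)) (q $ i))"
proof -
  have "0 < (\<Prod>i<n. exp (real (u $ i) * ln (real (u $ i)) - real (u $ i)) / fact (u $ i))"
    by (intro prod_pos) auto
  then show ?thesis
    by (simp add: poisson_prob_eq_kl[OF assms(1)] poisson_prob_eq_kl[OF assms(2)] mult_le_cancel_right)
qed

locale log_affine_model =
  fixes d n :: nat and A :: "nat mat" and B :: "int mat"
    and lam :: "real vec" and U :: "nat vec"
  assumes d_pos: "0 < d"
    and A: "A \<in> carrier_mat d n"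
    and rank: "vec_space.rank d (real_mat_of_nat A) = d"
    and gale: "gale_transform A B"
    and lam: "lam \<in> carrier_vec (n - d)"
    and U: "U \<in> carrier_vec n"
    and interior: "real_mat_of_nat A *\<^sub>v real_vec_of_nat U
      \<in> (vec_topology d) interior_of (column_cone A)"
begin

abbreviation "k \<equiv> n - d"
abbreviation "Ar \<equiv> real_mat_of_nat A"
abbreviation "R \<equiv> real_mat_of_int B"
abbreviation "Ur \<equiv> real_vec_of_nat U"
abbreviation "w \<equiv> base_vec B lam"

lemma Ar: "Ar \<in> carrier_mat d n" using A by simp

lemma Ur: "Ur \<in> carrier_vec n" using U by simp

lemma d_le_n: "d \<le> n"
  using vec_space.rank_le_nc[OF Ar] rank by simp

lemma B: "B \<in> carrier_mat k n"
  using gale A by (simp add: gale_transform_def)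

lemma R: "R \<in> carrier_mat k n" using B by simp

lemma A_surj: "v \<in> carrier_vec d \<Longrightarrow> \<exists>y\<in>carrier_vec n. Ar *\<^sub>v y = v"
  by (rule interior_column_cone_surj[OF A interior Ur])

lemma A_transpose_inj:
  assumes v: "v \<in> carrier_vec d" and "transpose_mat Ar *\<^sub>v v = 0\<^sub>v n"
  shows "v = 0\<^sub>v d"
proof (rule scalar_prod_self_eq_0D[OF v])
  obtain y where y: "y \<in> carrier_vec n" "Ar *\<^sub>v y = v" using A_surj[OF v] by blast
  have "v \<bullet> (Ar *\<^sub>v y) = (transpose_mat Ar *\<^sub>v v) \<bullet> y"
    by (rule transpose_vec_mult_scalar[OF Ar y(1) v, symmetric])
  then show "v \<bullet> v = 0" using y assms by simp
qed

text \<open>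
  The integer combinations of the rows of \<open>B\<close> lie in the kernel of \<open>A\<close>; apply this to the single rows.
\<close>

lemma A_R_transpose: "Ar * transpose_mat R = 0\<^sub>m d k"
proof -
  let ?A = "map_mat int A"
  have A': "?A \<in> carrier_mat d n" using A by simp
  have "?A * transpose_mat B = 0\<^sub>m d k"
  proof (rule eq_matI)
    fix j i assume ji: "j < dim_row (0\<^sub>m d k :: int mat)" "i < dim_col (0\<^sub>m d k :: int mat)"
    have "transpose_mat B *\<^sub>v unit_vec k i
        \<in> {transpose_mat B *\<^sub>v c | c. c \<in> carrier_vec (dim_row B)}"
      using B by auto
    also have "\<dots> = mat_kernel ?A" using gale by (simp add: gale_transform_def)
    finally have "transpose_mat B *\<^sub>v unit_vec k i \<in> mat_kernel ?A" .
    then have "?A *\<^sub>v (transpose_mat B *\<^sub>v unit_vec k i) = 0\<^sub>v d"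
      using mat_kernelD(2)[OF A'] by blast
    then have "((?A * transpose_mat B) *\<^sub>v unit_vec k i) $ j = 0"
      using A B ji by (subst assoc_mult_mat_vec) auto
    moreover have "((?A * transpose_mat B) *\<^sub>v unit_vec k i) $ j = (?A * transpose_mat B) $$ (j, i)"
    proof -
      have "row (?A * transpose_mat B) j \<in> carrier_vec k" using A B by (intro carrier_vecI) simp
      then have "row (?A * transpose_mat B) j \<bullet> unit_vec k i = row (?A * transpose_mat B) j $ i"
        using ji by (intro scalar_prod_right_unit) auto
      then show ?thesis using A B ji by (simp del: assoc_mult_mat_vec)
    qed
    ultimately show "(?A * transpose_mat B) $$ (j, i) = 0\<^sub>m d k $$ (j, i)" using ji by simp
  qed (use A B in auto)
  then have "real_mat_of_int (?A * transpose_mat B) = 0\<^sub>m d k"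
    by (auto intro!: eq_matI)
  moreover have "real_mat_of_int (?A * transpose_mat B) = real_mat_of_int ?A * transpose_mat R"
    using A' B by (simp add: map_mat_transpose of_int_hom.mat_hom_mult[of ?A d n "transpose_mat B" k])
  moreover have "real_mat_of_int ?A = Ar" by (intro eq_matI) auto
  ultimately show ?thesis by simp
qed

lemma R_A_transpose: "R * transpose_mat Ar = 0\<^sub>m k d"
proof -
  have "R * transpose_mat Ar = transpose_mat (Ar * transpose_mat R)"
    using transpose_mult[OF Ar, of "transpose_mat R" k] R by simp
  then show ?thesis by (simp add: A_R_transpose)
qed

lemma R_mult_A_transpose:
  assumes v: "v \<in> carrier_vec d"
  shows "R *\<^sub>v (transpose_mat Ar *\<^sub>v v) = 0\<^sub>v k"
proof -
  have "R *\<^sub>v (transpose_mat Ar *\<^sub>v v) = (R * transpose_mat Ar) *\<^sub>v v"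
    using Ar R v by (intro assoc_mult_mat_vec[symmetric]) auto
  then show ?thesis using v unfolding R_A_transpose by (auto intro!: eq_vecI)
qed

lemma gram_inverse:
  obtains G where "mat_inverse (R * transpose_mat R) = Some G" "G \<in> carrier_mat k k"
    "R * transpose_mat R * G = 1\<^sub>m k" "G * (R * transpose_mat R) = 1\<^sub>m k"
proof (rule integer_gram_inverse[OF B])
  show "c = 0\<^sub>v k" if "c \<in> carrier_vec k" "transpose_mat B *\<^sub>v c = 0\<^sub>v n" for c
    using gale that B by (auto simp: gale_transform_def)
qed

lemma base_vec_carrier: "w \<in> carrier_vec n"
  using R by (intro carrier_vecI) (simp add: base_vec_def Let_def)

lemma R_base_vec: "R *\<^sub>v w = lam"
proof -
  obtain G where G: "mat_inverse (R * transpose_mat R) = Some G" "G \<in> carrier_mat k k"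
    "R * transpose_mat R * G = 1\<^sub>m k"
    using gram_inverse .
  have "R *\<^sub>v w = R *\<^sub>v (transpose_mat R *\<^sub>v (G *\<^sub>v lam))"
    by (simp add: base_vec_def Let_def G(1))
  also have "\<dots> = (R * transpose_mat R) *\<^sub>v (G *\<^sub>v lam)"
    using R G lam by (intro assoc_mult_mat_vec[symmetric]) auto
  also have "\<dots> = (R * transpose_mat R * G) *\<^sub>v lam"
    using R G lam by (intro assoc_mult_mat_vec[symmetric]) auto
  also have "\<dots> = lam" using G lam by simp
  finally show ?thesis .
qed

text \<open>
  The kernel of \<open>A\<close> is the row space of \<open>R\<close>, and the row space of a matrix is orthogonal to its kernel.
\<close>

lemma kernels_orthogonal:
  assumes y: "y \<in> carrier_vec n" "Ar *\<^sub>v y = 0\<^sub>v d" and z: "z \<in> carrier_vec n" "R *\<^sub>v z = 0\<^sub>v k"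
  shows "y \<bullet> z = 0"
proof -
  obtain G where "G \<in> carrier_mat k k"
    "R * transpose_mat R * G = 1\<^sub>m k" "G * (R * transpose_mat R) = 1\<^sub>m k"
    using gram_inverse .
  from kernel_eq_row_span[OF Ar R d_le_n A_surj A_R_transpose this y]
  obtain c where c: "c \<in> carrier_vec k" "y = transpose_mat R *\<^sub>v c" .
  have "y \<bullet> z = c \<bullet> (R *\<^sub>v z)"
    unfolding c(2) by (rule transpose_vec_mult_scalar[OF R z(1) c(1)])
  then show ?thesis using c(1) z(2) by simp
qed

lemma A_entry_mult:
  assumes "j < d" "x \<in> carrier_vec n"
  shows "(Ar *\<^sub>v x) $ j = (\<Sum>i<n. real (A $$ (j, i)) * x $ i)"
  using A assms by (simp add: scalar_prod_def lessThan_atLeast0)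

lemma A_transpose_entry_mult:
  assumes "i < n" "v \<in> carrier_vec d"
  shows "(transpose_mat Ar *\<^sub>v v) $ i = (\<Sum>j<d. real (A $$ (j, i)) * v $ j)"
  using A assms by (simp add: scalar_prod_def lessThan_atLeast0)

lemma sufficient_statistic:
  assumes "j < d"
  shows "real ((A *\<^sub>v U) $ j) = (Ar *\<^sub>v Ur) $ j"
  using A U assms by (simp add: scalar_prod_def)

lemma model_point_pos:
  assumes "\<theta> \<in> carrier_vec d"
  shows "model_point A B lam \<theta> \<in> pos_vecs n"
  using base_vec_carrier Ar assms by (auto simp: model_point_def pos_vecs_def)

lemma model_point_entry:
  assumes "i < n" "\<theta> \<in> carrier_vec d"
  shows "model_point A B lam \<theta> $ i = exp (w $ i + (transpose_mat Ar *\<^sub>v \<theta>) $ i)"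
proof -
  have "transpose_mat Ar *\<^sub>v \<theta> \<in> carrier_vec n" using Ar assms by simp
  then show ?thesis
    using A base_vec_carrier assms by (simp add: model_point_def del: index_mult_mat_vec)
qed

lemma log_model_point_diff:
  assumes "\<theta> \<in> carrier_vec d" "\<theta>' \<in> carrier_vec d" "i < n"
  shows "ln (model_point A B lam \<theta> $ i) - ln (model_point A B lam \<theta>' $ i)
    = (transpose_mat Ar *\<^sub>v (\<theta> - \<theta>')) $ i"
proof -
  have "transpose_mat Ar *\<^sub>v (\<theta> - \<theta>') = transpose_mat Ar *\<^sub>v \<theta> - transpose_mat Ar *\<^sub>v \<theta>'"
    using Ar assms by (intro mult_minus_distrib_mat_vec[of _ n d]) auto
  then show ?thesis
    using Ar assms by (simp add: model_point_entry del: index_mult_mat_vec)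
qed

lemma model_point_inj:
  assumes "\<theta> \<in> carrier_vec d" "\<theta>' \<in> carrier_vec d"
    and "\<And>i. i < n \<Longrightarrow> model_point A B lam \<theta> $ i = model_point A B lam \<theta>' $ i"
  shows "\<theta> = \<theta>'"
proof -
  have "transpose_mat Ar *\<^sub>v (\<theta> - \<theta>') = 0\<^sub>v n"
  proof (rule eq_vecI)
    fix i assume "i < dim_vec (0\<^sub>v n :: real vec)"
    then show "(transpose_mat Ar *\<^sub>v (\<theta> - \<theta>')) $ i = 0\<^sub>v n $ i"
      using log_model_point_diff[OF assms(1,2), of i] assms(3)[of i] by simp
  qed (use Ar in simp)
  then have *: "\<theta> - \<theta>' = 0\<^sub>v d" using assms by (intro A_transpose_inj) auto
  show ?thesis
  proof (rule eq_vecI)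
    fix i assume "i < dim_vec \<theta>'"
    then show "\<theta> $ i = \<theta>' $ i"
      using assms(1,2) arg_cong[OF *, of "\<lambda>v. v $ i"] by simp
  qed (use assms in simp)
qed

lemma log_model_point:
  assumes \<theta>: "\<theta> \<in> carrier_vec d"
  shows "R *\<^sub>v log_vec (model_point A B lam \<theta>) = lam"
proof -
  have A\<theta>: "transpose_mat Ar *\<^sub>v \<theta> \<in> carrier_vec n" using Ar \<theta> by simp
  have "log_vec (model_point A B lam \<theta>) = w + transpose_mat Ar *\<^sub>v \<theta>"
    using base_vec_carrier A\<theta> unfolding model_point_def by (intro eq_vecI) (auto simp del: index_mult_mat_vec)
  then have "R *\<^sub>v log_vec (model_point A B lam \<theta>) = R *\<^sub>v w + R *\<^sub>v (transpose_mat Ar *\<^sub>v \<theta>)"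
    using mult_add_distrib_mat_vec[OF R base_vec_carrier A\<theta>] by simp
  then show ?thesis using R_base_vec R_mult_A_transpose[OF \<theta>] lam by simp
qed

text \<open>
  Along the model the difference of logarithms is in the image of the transpose of \<open>A\<close>, whereas
  \<open>U\<close> minus a fitting point is in the kernel of \<open>A\<close>, so the mixed term vanishes.
\<close>

lemma model_pythagoras:
  assumes \<theta>: "\<theta> \<in> carrier_vec d" "\<theta>' \<in> carrier_vec d"
    and fit: "Ar *\<^sub>v model_point A B lam \<theta> = Ar *\<^sub>v Ur"
  shows "(\<Sum>i<n. kl (Ur $ i) (model_point A B lam \<theta>' $ i))
    = (\<Sum>i<n. kl (Ur $ i) (model_point A B lam \<theta> $ i))
      + (\<Sum>i<n. kl (model_point A B lam \<theta> $ i) (model_point A B lam \<theta>' $ i))"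
proof -
  let ?p = "model_point A B lam \<theta>" and ?q = "model_point A B lam \<theta>'"
  have p: "?p \<in> carrier_vec n" using model_point_pos[OF \<theta>(1)] by (simp add: pos_vecs_def)
  have "(\<Sum>i<n. (Ur $ i - ?p $ i) * (ln (?p $ i) - ln (?q $ i)))
      = (transpose_mat Ar *\<^sub>v (\<theta> - \<theta>')) \<bullet> (Ur - ?p)"
    unfolding scalar_prod_def using p Ur
    by (intro sum.cong) (auto simp: log_model_point_diff[OF \<theta>] mult.commute simp del: index_mult_mat_vec)
  also have "\<dots> = (\<theta> - \<theta>') \<bullet> (Ar *\<^sub>v (Ur - ?p))"
    using \<theta> p Ur by (intro transpose_vec_mult_scalar[OF Ar]) auto
  also have "Ar *\<^sub>v (Ur - ?p) = 0\<^sub>v d"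
    using mult_minus_distrib_mat_vec[OF Ar Ur p] fit Ar Ur by simp
  finally have "(\<Sum>i<n. (Ur $ i - ?p $ i) * (ln (?p $ i) - ln (?q $ i))) = 0"
    using \<theta> by simp
  then show ?thesis
    using kl_pythagoras[of "Ur $ i" "?q $ i" "?p $ i" for i] by (simp add: sum.distrib)
qed

lemma fit_imp_unique_mle:
  assumes \<theta>: "\<theta> \<in> carrier_vec d" and fit: "Ar *\<^sub>v model_point A B lam \<theta> = Ar *\<^sub>v Ur"
  shows "is_mle A B lam U \<theta>" and "is_mle A B lam U \<theta>' \<Longrightarrow> \<theta>' = \<theta>"
proof -
  let ?p = "model_point A B lam"
  have rows: "dim_row A = d" using A by simp
  have Ui: "Ur $ i = real (U $ i)" if "i < n" for i using U that by simp
  have le_iff: "poisson_prob (?p \<theta>1) U \<le> poisson_prob (?p \<theta>2) U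
      \<longleftrightarrow> (\<Sum>i<n. kl (Ur $ i) (?p \<theta>2 $ i)) \<le> (\<Sum>i<n. kl (Ur $ i) (?p \<theta>1 $ i))"
    if "\<theta>1 \<in> carrier_vec d" "\<theta>2 \<in> carrier_vec d" for \<theta>1 \<theta>2
    using poisson_prob_le_iff[OF model_point_pos[OF that(2)] model_point_pos[OF that(1)], of U]
    by (simp add: Ui)
  have pos: "0 < ?p \<eta> $ i" if "\<eta> \<in> carrier_vec d" "i < n" for \<eta> i
    using model_point_pos[OF that(1)] that(2) by (simp add: pos_vecs_def)
  have "poisson_prob (?p \<eta>) U \<le> poisson_prob (?p \<theta>) U" if \<eta>: "\<eta> \<in> carrier_vec d" for \<eta>
  proof -
    have "0 \<le> (\<Sum>i<n. kl (?p \<theta> $ i) (?p \<eta> $ i))"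
      using pos[OF \<theta>] pos[OF \<eta>] by (intro sum_nonneg kl_nonneg) (auto intro: less_imp_le)
    then show ?thesis
      unfolding le_iff[OF \<eta> \<theta>] model_pythagoras[OF \<theta> \<eta> fit] by simp
  qed
  then show "is_mle A B lam U \<theta>" using \<theta> by (simp add: is_mle_def rows)
  assume mle: "is_mle A B lam U \<theta>'"
  then have \<theta>': "\<theta>' \<in> carrier_vec d" by (simp add: is_mle_def rows)
  have "poisson_prob (?p \<theta>) U \<le> poisson_prob (?p \<theta>') U"
    using mle \<theta> by (simp add: is_mle_def rows)
  then have "(\<Sum>i<n. kl (?p \<theta> $ i) (?p \<theta>' $ i)) \<le> 0"
    unfolding le_iff[OF \<theta> \<theta>'] model_pythagoras[OF \<theta> \<theta>' fit] by simp
  then have "?p \<theta> $ i = ?p \<theta>' $ i" if "i < n" for i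
    using that pos[OF \<theta>] pos[OF \<theta>']
    by (intro sum_kl_eq_0D[of "{..<n}" "\<lambda>i. ?p \<theta> $ i" "\<lambda>i. ?p \<theta>' $ i"]) (auto intro: less_imp_le)
  then show "\<theta>' = \<theta>" using model_point_inj[OF \<theta> \<theta>'] by simp
qed

text \<open>
  The differences \<open>x - y\<close> and \<open>ln x - ln y\<close> lie in orthogonal subspaces. Their scalar product is the
  symmetrised divergence of \<open>x\<close> and \<open>y\<close>, which vanishes only for equal points.
\<close>

lemma fit_unique:
  assumes x: "x \<in> pos_vecs n" and y: "y \<in> pos_vecs n"
    and fit: "Ar *\<^sub>v x = Ar *\<^sub>v y" and log: "R *\<^sub>v log_vec x = R *\<^sub>v log_vec y"
  shows "x = y"
proof -
  have c: "x \<in> carrier_vec n" "y \<in> carrier_vec n" using x y by (auto simp: pos_vecs_def)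
  have pos: "0 < x $ i" "0 < y $ i" if "i < n" for i using x y that by (auto simp: pos_vecs_def)
  have "Ar *\<^sub>v (x - y) = 0\<^sub>v d"
    using mult_minus_distrib_mat_vec[OF Ar c] fit Ar c by simp
  moreover have "R *\<^sub>v (log_vec x - log_vec y) = 0\<^sub>v k"
    using mult_minus_distrib_mat_vec[OF R, of "log_vec x" "log_vec y"] log R c by simp
  ultimately have "(x - y) \<bullet> (log_vec x - log_vec y) = 0"
    using c by (intro kernels_orthogonal) auto
  moreover have "(x - y) \<bullet> (log_vec x - log_vec y)
      = (\<Sum>i<n. (x $ i - y $ i) * (ln (x $ i) - ln (y $ i)))"
    using c by (simp add: scalar_prod_def lessThan_atLeast0)
  moreover have "\<dots> = (\<Sum>i<n. kl (x $ i) (y $ i)) + (\<Sum>i<n. kl (y $ i) (x $ i))"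
    unfolding sum.distrib[symmetric] by (intro sum.cong) (auto simp: kl_def algebra_simps)
  moreover have "0 \<le> (\<Sum>i<n. kl (y $ i) (x $ i))"
    using pos by (intro sum_nonneg kl_nonneg) (auto intro: less_imp_le)
  ultimately have "(\<Sum>i<n. kl (x $ i) (y $ i)) \<le> 0" by linarith
  then have "x $ i = y $ i" if "i < n" for i
    using that pos
    by (intro sum_kl_eq_0D[of "{..<n}" "\<lambda>i. x $ i" "\<lambda>i. y $ i"]) (auto intro: less_imp_le)
  then show ?thesis using c by (intro eq_vecI) auto
qed

section \<open>Iterative proportional scaling in the model\<close>

text \<open>
  The right-hand side is positive because \<open>AU\<close> is also the image of a positive vector and no row of
  \<open>A\<close> is zero.
\<close>

lemma ips_equation_ex1:
  assumes m: "m \<in> pos_vecs n" and j: "j < d"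
  shows "\<exists>!\<mu>. ips_equation A U j m \<mu>"
proof -
  obtain x where x: "x \<in> pos_vecs n" "Ar *\<^sub>v x = Ar *\<^sub>v Ur"
    using interior_column_cone_positive[OF A interior] .
  have xc: "x \<in> carrier_vec n" and x_pos: "\<And>i. i < n \<Longrightarrow> 0 < x $ i"
    using x(1) by (auto simp: pos_vecs_def)
  obtain y where y: "y \<in> carrier_vec n" "Ar *\<^sub>v y = unit_vec d j"
    using A_surj[of "unit_vec d j"] by auto
  have "(\<Sum>i<n. real (A $$ (j, i)) * y $ i) = 1"
    using A_entry_mult[OF j y(1)] j unfolding y(2) by simp
  then have "(\<Sum>i<n. real (A $$ (j, i)) * y $ i) \<noteq> 0" by simp
  then obtain l where l: "l < n" "A $$ (j, l) \<noteq> 0"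
    by (metis (no_types, lifting) lessThan_iff mult_eq_0_iff of_nat_0 sum.neutral)
  have "0 < real (A $$ (j, l)) * x $ l" using l x_pos by simp
  also have "\<dots> \<le> (\<Sum>i<n. real (A $$ (j, i)) * x $ i)"
    using l x_pos by (intro member_le_sum[of l _ "\<lambda>i. real (A $$ (j, i)) * x $ i"])
      (auto intro!: mult_nonneg_nonneg less_imp_le[OF x_pos])
  finally have "0 < real ((A *\<^sub>v U) $ j)"
    by (simp only: sufficient_statistic[OF j] x(2)[symmetric] A_entry_mult[OF j xc])
  then show ?thesis
    unfolding ips_equation_def using A l m
    by (simp only: carrier_matD(2)[OF A])
      (intro proportional_fit_ex1[of n "\<lambda>i. m $ i" l], auto simp: pos_vecs_def)
qed

lemma ips_pos: "ips A B lam U t \<in> pos_vecs n"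
proof (induction t)
  case 0
  then show ?case using base_vec_carrier by (auto simp: pos_vecs_def)
next
  case (Suc t)
  then show ?case using A by (auto simp: pos_vecs_def Let_def)
qed

lemma ips_converges:
  obtains \<beta> where "\<beta> \<in> carrier_vec d"
    and "limitin (vec_topology n) (ips A B lam U) (model_point A B lam \<beta>) sequentially"
    and "Ar *\<^sub>v model_point A B lam \<beta> = Ar *\<^sub>v Ur"
proof -
  obtain x where x: "x \<in> pos_vecs n" "Ar *\<^sub>v x = Ar *\<^sub>v Ur"
    using interior_column_cone_positive[OF A interior] .
  have xc: "x \<in> carrier_vec n" using x(1) by (simp add: pos_vecs_def)
  have "\<exists>y\<in>carrier_vec n. Ar *\<^sub>v y = unit_vec d j" for j by (rule A_surj) simp
  then obtain g where g: "\<And>j. g j \<in> carrier_vec n" "\<And>j. Ar *\<^sub>v g j = unit_vec d j" by metis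
  let ?m = "ips A B lam U"
  define \<mu> where "\<mu> t = (THE \<mu>. ips_equation A U (t mod d) (?m t) \<mu>)" for t
  have jd: "t mod d < d" for t using d_pos by simp
  have step: "?m (Suc t) $ i = ?m t $ i * exp (\<mu> t * real (A $$ (t mod d, i)))" if "i < n" for t i
    using A that by (simp add: Let_def \<mu>_def)
  have eq: "ips_equation A U (t mod d) (?m t) (\<mu> t)" for t
    unfolding \<mu>_def by (rule theI'[OF ips_equation_ex1[OF ips_pos jd]])
  interpret iterative_scaling d n "\<lambda>j i. real (A $$ (j, i))" "\<lambda>j i. g j $ i" "\<lambda>i. x $ i" "\<lambda>t i. ?m t $ i" \<mu>
  proof
    show "0 < d" by (rule d_pos)
    show "0 < x $ i" if "i < n" for i using x(1) that by (simp add: pos_vecs_def)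
    show "0 < ?m 0 $ i" if "i < n" for i using ips_pos[of 0] that by (simp add: pos_vecs_def)
    show "?m (Suc t) $ i = ?m t $ i * exp (\<mu> t * real (A $$ (t mod d, i)))" if "i < n" for t i
      by (rule step[OF that])
    show "(\<Sum>i<n. real (A $$ (t mod d, i)) * ?m (Suc t) $ i)
        = (\<Sum>i<n. real (A $$ (t mod d, i)) * x $ i)" for t
    proof -
      have "(\<Sum>i<n. real (A $$ (t mod d, i)) * ?m (Suc t) $ i)
          = (\<Sum>i<n. real (A $$ (t mod d, i)) * ?m t $ i * exp (\<mu> t * real (A $$ (t mod d, i))))"
        by (intro sum.cong) (simp_all only: lessThan_iff step mult.assoc)
      also have "\<dots> = real ((A *\<^sub>v U) $ (t mod d))"
        using eq[of t] A by (simp only: ips_equation_def carrier_matD(2)[OF A])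
      also have "\<dots> = (\<Sum>i<n. real (A $$ (t mod d, i)) * x $ i)"
        by (simp only: sufficient_statistic[OF jd] x(2)[symmetric] A_entry_mult[OF jd xc])
      finally show ?thesis .
    qed
    show "(\<Sum>i<n. real (A $$ (l, i)) * g j $ i) = (if l = j then 1 else 0)" if "j < d" "l < d" for j l
      using A_entry_mult[OF that(2) g(1)[of j]] that unfolding g(2) by simp
  qed
  obtain p b where p: "\<And>i. i < n \<Longrightarrow> (\<lambda>t. ?m t $ i) \<longlonglongrightarrow> p i"
    and p_eq: "\<And>i. i < n \<Longrightarrow> p i = ?m 0 $ i * exp (\<Sum>j<d. real (A $$ (j, i)) * b j)"
    and p_fit: "\<And>j. j < d \<Longrightarrow>
      (\<Sum>i<n. real (A $$ (j, i)) * p i) = (\<Sum>i<n. real (A $$ (j, i)) * x $ i)"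
    by (rule m_converges) (use that in blast)
  define \<beta> where "\<beta> = vec d b"
  have \<beta>: "\<beta> \<in> carrier_vec d" by (simp add: \<beta>_def)
  let ?p = "model_point A B lam \<beta>"
  have pc: "?p \<in> carrier_vec n" using model_point_pos[OF \<beta>] by (simp add: pos_vecs_def)
  have entry: "?p $ i = p i" if i: "i < n" for i
  proof -
    have "(transpose_mat Ar *\<^sub>v \<beta>) $ i = (\<Sum>j<d. real (A $$ (j, i)) * b j)"
      unfolding A_transpose_entry_mult[OF i \<beta>] by (intro sum.cong) (auto simp: \<beta>_def)
    then show ?thesis
      using i base_vec_carrier by (simp add: p_eq[OF i] model_point_entry[OF i \<beta>] exp_add)
  qed
  have "limitin (vec_topology n) ?m ?p sequentially"
    unfolding limitin_vec_topology using pc p entry ips_pos by (auto simp: pos_vecs_def)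
  moreover have "Ar *\<^sub>v ?p = Ar *\<^sub>v Ur"
  proof (rule eq_vecI)
    fix j assume "j < dim_vec (Ar *\<^sub>v Ur)"
    then have j: "j < d" using A by simp
    show "(Ar *\<^sub>v ?p) $ j = (Ar *\<^sub>v Ur) $ j"
      by (simp add: x(2)[symmetric] A_entry_mult[OF j] pc xc p_fit[OF j, symmetric] entry del: index_mult_mat_vec)
  qed simp
  ultimately show ?thesis using \<beta> that by blast
qed

end

theorem theorem3:
  fixes d n :: nat
    and A :: "nat mat" and Abar :: "int mat"
    and lam :: "real vec" and U :: "nat vec"
  assumes "0 < d"
    and "A \<in> carrier_mat d n"
    and "vec_space.rank d (real_mat_of_nat A) = d"
    and "configuration_matrix A"
    and "gale_transform A Abar"
    and "lam \<in> carrier_vec (n - d)"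
    and "U \<in> carrier_vec n"
    and "real_mat_of_nat A *\<^sub>v real_vec_of_nat U \<in> (vec_topology d) interior_of (column_cone A)"
  shows "(\<forall>t. ips A Abar lam U t \<in> pos_vecs n \<and>
              (\<exists>!\<mu>. ips_equation A U (t mod d) (ips A Abar lam U t) \<mu>)) \<and>
    (\<exists>m. limitin (vec_topology n) (ips A Abar lam U) m sequentially \<and>
      (\<exists>\<theta>. is_mle A Abar lam U \<theta> \<and> (\<forall>\<theta>'. is_mle A Abar lam U \<theta>' \<longrightarrow> \<theta>' = \<theta>) \<and>
           m = model_point A Abar lam \<theta>) \<and>
      (\<forall>x. x \<in> pos_vecs n \<and>
           real_mat_of_nat A *\<^sub>v real_vec_of_nat U = real_mat_of_nat A *\<^sub>v x \<and>
           lam = real_mat_of_int Abar *\<^sub>v log_vec x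
         \<longleftrightarrow> x = m))"
proof -
  interpret log_affine_model d n A Abar lam U
    using assms by unfold_locales
  obtain \<beta> where \<beta>: "\<beta> \<in> carrier_vec d"
    and lim: "limitin (vec_topology n) (ips A Abar lam U) (model_point A Abar lam \<beta>) sequentially"
    and fit: "Ar *\<^sub>v model_point A Abar lam \<beta> = Ar *\<^sub>v Ur"
    using ips_converges .
  have characterisation: "x \<in> pos_vecs n \<and> Ar *\<^sub>v Ur = Ar *\<^sub>v x \<and> lam = R *\<^sub>v log_vec x
      \<longleftrightarrow> x = model_point A Abar lam \<beta>" for x
    using fit_unique[OF _ model_point_pos[OF \<beta>], of x] model_point_pos[OF \<beta>] fit log_model_point[OF \<beta>]
    by auto
  have "ips A Abar lam U t \<in> pos_vecs n \<and>
      (\<exists>!\<mu>. ips_equation A U (t mod d) (ips A Abar lam U t) \<mu>)" for t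
    using ips_equation_ex1[OF ips_pos mod_less_divisor[OF assms(1)]] ips_pos by blast
  then show ?thesis
    using lim characterisation fit_imp_unique_mle[OF \<beta> fit] by blast
qed

end
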